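(* Let $p$ be an odd prime, let $\sigma\subset\mathbb{C}_p$ be compact and let $\mu\in\mathbf{L}^*(\sigma)$. There exists a nonempty open set $\Omega\subset\mathbb{C}_p$ such that for every $\lambda\in\Omega$ and every $s\in\mathbb{Z}_p\setminus\{1\}$ the expression $$\zeta_p^\mu(s,\lambda)=\frac{1}{s-1}\int_\sigma\langle\lambda+x\rangle^{1-s}\,d\mu(x)$$ is well-defined. Moreover, $\zeta_p^\mu(s,\lambda)$ is $C^\infty$ in $s$ on $\mathbb{Z}_p\setminus\{1\}$ (for each $\lambda\in\Omega$) and locally analytic in $\lambda$ on $\Omega$ (for each $s\in\mathbb{Z}_p\setminus\{1\}$).
   Context: Notation. $\mathbb{C}_p$ is the completion of an algebraic closure of $\mathbb{Q}_p$, $|p|_p=p^{-1}$, $v_p$ is the additive valuation with $v_p(p)=1$. Fix a compatible system of fractional powers $p^r\in\mathbb{C}_p$, $r\in\mathbb{Q}$ (with $p^{r+r'}=p^rp^{r'}$ and $p^1=p$). For $a\in\mathbb{C}_p^\times$ write $a=p^{v_p(a)}u$ with $|u|_p=1$, let $\hat a=\lim_{n\to\infty}u^{p^{n!}}$ (the root of unity of order prime to $p$ with $|\hat a-u|_p<1$), and put $\omega_v(a)=p^{v_p(a)}\hat a$ and $\langle a\rangle=a/\omega_v(a)$, so $|\langle a\rangle-1|_p<1$. For $s\in\mathbb{Z}_p$, $\langle a\rangle^s=\sum_{n\ge0}\binom{s}{n}(\langle a\rangle-1)^n$. Locally analytic functions and generalized distributions. For compact $\sigma\subset\mathbb{C}_p$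 and $r>0$ let $D_a(r)=\{z\in\mathbb{C}_p:|z-a|_p<r\}$ and $\mathbb{D}_\sigma(r)=\bigcup_{a\in\sigma}D_a(r)$. $B_r(\sigma)$ is the Banach space of functions $f$ on $\mathbb{D}_\sigma(r)$ given by a convergent power series on each $D_a(r)$, $a\in\sigma$, with finite norm $\|f\|_r=\sup_{z\in\mathbb{D}_\sigma(r)}|f(z)|_p$. $\mathbf{L}(\sigma)$, the space of locally analytic functions on $\sigma$, is the union (inductive limit over $r\to0$, functions being identified if they agree on some $\mathbb{D}_\sigma(r')$) of the $B_r(\sigma)$, with the inductive limit topology. $\mathbf{L}^*(\sigma)$ is the space of continuous $\mathbb{C}_p$-linear maps $\mu:\mathbf{L}(\sigma)\to\mathbb{C}_p$ (generalized distributions); one writes $\int_\sigma f\,d\mu=\mu(f)$. The support $\mathrm{supp}(\mu)$ is the complement in $\sigma$ of the largest open $U\subset\sigma$ on which $\mu$ vanishes (i.e. $\mu(f)=0$ for all $f\in\mathbf{L}(\sigma)$ supported in a clopen subset of $\sigma$ contained in $U$). The function $\zeta_p^\mu(s,\lambda)$ is defined for $s\in\mathbb{Z}_p\setminus\{1\}$ and $-\lambda\notin\mathrm{supp}(\mu)$. If a function $\varphi$ is locally analytic only on a clopen neighbourhood $U$ of $\mathrm{supp}(\mu)$ in $\sigma$, $\int_\sigma\varphi\,d\mu$ means $\mu$ applied to the function equal to $\varphi$ on $U$ and $0$ on $\sigma\setminus U$. A function on $X\subset\mathbb{Z}_p$ is $C^n$ if its $n$-th iterated difference quotient extends continuously to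 $X^{n+1}$, and $C^\infty$ if it is $C^n$ for all $n$. A function on an open subset of $\mathbb{C}_p$ is locally analytic if near each point it is given by a convergent power series. *)

theory Defs
  imports "HOL-Analysis.Analysis"
begin

section \<open>The field of $p$-adic complex numbers\<close>

text \<open>
  The library has no type of $p$-adic numbers, so the field is described as a type
  \<open>'c\<close> that is a completion of an algebraic closure of the $p$-adic numbers (this determines
  it up to isometric isomorphism). Its absolute value is the distance to \<open>0\<close>; in this way
  open and compact sets, limits and sums are those of the library. The class
  \<open>real_normed_field\<close> is not applicable, since it requires a real algebra.
\<close>

definition vabs :: "'c::{zero, metric_space} \<Rightarrow> real"
  where "vabs x = dist x 0"

text \<open>The completion of the rationals, inside a complete field.\<close>

definition Qp :: "'c::{field_char_0, complete_space} set"
  where "Qp = closure \<rat>"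

definition Zp :: "'c::{field_char_0, complete_space} set"
  where "Zp = {x \<in> Qp. vabs x \<le> 1}"

definition Qp_alg :: "'c::{field_char_0, complete_space} set"
  where "Qp_alg = {x. \<exists>P. P \<noteq> 0 \<and> (\<forall>i. coeff P i \<in> Qp) \<and> poly P x = 0}"

text \<open>
  The first four conditions make \<open>vabs\<close> a non-archimedean absolute value that restricts to the
  $p$-adic one on the rationals and induces the metric; completeness is part of the sort.
  The last two say that the elements algebraic over \<open>Qp\<close> are an algebraic closure of \<open>Qp\<close>
  and that this closure is dense.
\<close>

definition is_Cp :: "nat \<Rightarrow> 'c::{field_char_0, complete_space} itself \<Rightarrow> bool"
  where "is_Cp p T \<longleftrightarrow>
    (\<forall>x y :: 'c. dist x y = vabs (x - y)) \<and>
    (\<forall>x y :: 'c. vabs (x * y) = vabs x * vabs y) \<and>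
    (\<forall>x y :: 'c. vabs (x + y) \<le> max (vabs x) (vabs y)) \<and>
    vabs (of_nat p :: 'c) = 1 / real p \<and>
    (\<forall>P :: 'c poly. degree P > 0 \<and> (\<forall>i. coeff P i \<in> Qp_alg) \<longrightarrow> (\<exists>x \<in> Qp_alg. poly P x = 0)) \<and>
    closure (Qp_alg :: 'c set) = UNIV"

definition fractional_powers :: "nat \<Rightarrow> (rat \<Rightarrow> 'c::field_char_0) \<Rightarrow> bool"
  where "fractional_powers p ppow \<longleftrightarrow>
    (\<forall>r r'. ppow (r + r') = ppow r * ppow r') \<and> ppow 1 = of_nat p"


section \<open>The function $\langle a\rangle^s$\<close>

text \<open>On nonzero elements the additive valuation takes rational values, as needed to form
  \<open>ppow (val p a)\<close>.\<close>

definition val :: "nat \<Rightarrow> 'c::{zero, metric_space} \<Rightarrow> rat"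
  where "val p a = (THE r. vabs a = real p powr (- of_rat r))"

definition unit_part :: "nat \<Rightarrow> (rat \<Rightarrow> 'c) \<Rightarrow> 'c::{field_char_0, complete_space} \<Rightarrow> 'c"
  where "unit_part p ppow a = a / ppow (val p a)"

definition teich :: "nat \<Rightarrow> (rat \<Rightarrow> 'c) \<Rightarrow> 'c::{field_char_0, complete_space} \<Rightarrow> 'c"
  where "teich p ppow a = lim (\<lambda>n. unit_part p ppow a ^ (p ^ fact n))"

definition omega :: "nat \<Rightarrow> (rat \<Rightarrow> 'c) \<Rightarrow> 'c::{field_char_0, complete_space} \<Rightarrow> 'c"
  where "omega p ppow a = ppow (val p a) * teich p ppow a"

definition angle :: "nat \<Rightarrow> (rat \<Rightarrow> 'c) \<Rightarrow> 'c::{field_char_0, complete_space} \<Rightarrow> 'c"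
  where "angle p ppow a = a / omega p ppow a"

definition angle_pow :: "nat \<Rightarrow> (rat \<Rightarrow> 'c) \<Rightarrow> 'c::{field_char_0, complete_space} \<Rightarrow> 'c \<Rightarrow> 'c"
  where "angle_pow p ppow a s = (\<Sum>n. (s gchoose n) * (angle p ppow a - 1) ^ n)"

text \<open>All operations above are total in HOL; this is the condition under which the description,
  the limit, the quotient and the sum in \<open>angle_pow\<close> are meaningful.\<close>

definition angle_pow_defined ::
    "nat \<Rightarrow> (rat \<Rightarrow> 'c) \<Rightarrow> 'c::{field_char_0, complete_space} \<Rightarrow> 'c \<Rightarrow> bool"
  where "angle_pow_defined p ppow a s \<longleftrightarrow>
    a \<noteq> 0 \<and>
    (\<exists>!r. vabs a = real p powr (- of_rat r)) \<and>
    convergent (\<lambda>n. unit_part p ppow a ^ (p ^ fact n)) \<and>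
    omega p ppow a \<noteq> 0 \<and>
    summable (\<lambda>n. (s gchoose n) * (angle p ppow a - 1) ^ n)"


section \<open>Locally analytic functions and generalized distributions\<close>

definition nbhd :: "'c::metric_space set \<Rightarrow> real \<Rightarrow> 'c set"
  where "nbhd \<sigma> r = (\<Union>a\<in>\<sigma>. ball a r)"

text \<open>Functions on \<open>nbhd \<sigma> r\<close> are represented by total functions whose values elsewhere
  are irrelevant.\<close>

definition B :: "real \<Rightarrow> 'c::{field_char_0, complete_space} set \<Rightarrow> ('c \<Rightarrow> 'c) set"
  where "B r \<sigma> = {f.
    (\<forall>a\<in>\<sigma>. \<exists>c. \<forall>z\<in>ball a r. (\<lambda>n. c n * (z - a) ^ n) sums f z) \<and>
    bdd_above ((\<lambda>z. vabs (f z)) ` nbhd \<sigma> r)}"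

text \<open>Inserting \<open>0\<close> only matters for empty \<open>\<sigma>\<close>, where the supremum would be unspecified.\<close>

definition B_norm :: "real \<Rightarrow> 'c::{field_char_0, complete_space} set \<Rightarrow> ('c \<Rightarrow> 'c) \<Rightarrow> real"
  where "B_norm r \<sigma> f = Sup (insert 0 ((\<lambda>z. vabs (f z)) ` nbhd \<sigma> r))"

text \<open>
  An element of the space of locally analytic functions is a germ along \<open>\<sigma>\<close>: \<open>LA \<sigma>\<close> consists
  of the representatives, and \<open>same_germ\<close> is the identification. A map on germs is given by
  a map on \<open>LA \<sigma>\<close> that respects \<open>same_germ\<close>.
\<close>

definition LA :: "'c::{field_char_0, complete_space} set \<Rightarrow> ('c \<Rightarrow> 'c) set"
  where "LA \<sigma> = (\<Union>r\<in>{0<..}. B r \<sigma>)"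

definition same_germ :: "'c::{field_char_0, complete_space} set \<Rightarrow> ('c \<Rightarrow> 'c) \<Rightarrow> ('c \<Rightarrow> 'c) \<Rightarrow> bool"
  where "same_germ \<sigma> f g \<longleftrightarrow> (\<exists>r>0. \<forall>z\<in>nbhd \<sigma> r. f z = g z)"

text \<open>
  The (locally convex) inductive limit topology: a basis of neighbourhoods of \<open>0\<close> is given by
  the submodules over the ring of integers which meet every \<open>B r \<sigma>\<close> in a neighbourhood of
  \<open>0\<close>. Such a submodule contains every function with zero germ, so all open sets are
  saturated for \<open>same_germ\<close>, and the topology is the one pulled back from the space of germs.
\<close>

definition LA_zero_nbhd :: "'c::{field_char_0, complete_space} set \<Rightarrow> ('c \<Rightarrow> 'c) set \<Rightarrow> bool"
  where "LA_zero_nbhd \<sigma> N \<longleftrightarrow>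
    N \<subseteq> LA \<sigma> \<and>
    (\<forall>f\<in>N. \<forall>g\<in>N. (\<lambda>z. f z + g z) \<in> N) \<and>
    (\<forall>c. \<forall>f\<in>N. vabs c \<le> 1 \<longrightarrow> (\<lambda>z. c * f z) \<in> N) \<and>
    (\<forall>r>0. \<exists>\<epsilon>>0. \<forall>f\<in>B r \<sigma>. B_norm r \<sigma> f < \<epsilon> \<longrightarrow> f \<in> N)"

definition LA_open :: "'c::{field_char_0, complete_space} set \<Rightarrow> ('c \<Rightarrow> 'c) set \<Rightarrow> bool"
  where "LA_open \<sigma> V \<longleftrightarrow>
    V \<subseteq> LA \<sigma> \<and> (\<forall>f\<in>V. \<exists>N. LA_zero_nbhd \<sigma> N \<and> (\<forall>h\<in>N. (\<lambda>z. f z + h z) \<in> V))"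

definition LA_topology :: "'c::{field_char_0, complete_space} set \<Rightarrow> ('c \<Rightarrow> 'c) topology"
  where "LA_topology \<sigma> = topology (LA_open \<sigma>)"

lemma LA_zero_nbhd_Int:
  assumes "LA_zero_nbhd \<sigma> M" "LA_zero_nbhd \<sigma> N"
  shows "LA_zero_nbhd \<sigma> (M \<inter> N)"
proof -
  have "\<exists>\<epsilon>>0. \<forall>f\<in>B r \<sigma>. B_norm r \<sigma> f < \<epsilon> \<longrightarrow> f \<in> M \<inter> N" if r: "r > 0" for r
  proof -
    from assms(1) r obtain d where "d > 0" "\<forall>f\<in>B r \<sigma>. B_norm r \<sigma> f < d \<longrightarrow> f \<in> M"
      unfolding LA_zero_nbhd_def by blast
    moreover from assms(2) r obtain e where "e > 0" "\<forall>f\<in>B r \<sigma>. B_norm r \<sigma> f < e \<longrightarrow> f \<in> N"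
      unfolding LA_zero_nbhd_def by blast
    ultimately show ?thesis
      by (intro exI[of _ "min d e"]) auto
  qed
  with assms show ?thesis
    unfolding LA_zero_nbhd_def by blast
qed

lemma istopology_LA_open: "istopology (LA_open \<sigma>)"
  unfolding istopology_def
proof (intro conjI allI impI)
  fix S T assume S: "LA_open \<sigma> S" and T: "LA_open \<sigma> T"
  show "LA_open \<sigma> (S \<inter> T)"
    unfolding LA_open_def
  proof (intro conjI ballI)
    show "S \<inter> T \<subseteq> LA \<sigma>" using S unfolding LA_open_def by blast
    fix f assume "f \<in> S \<inter> T"
    then obtain M N where "LA_zero_nbhd \<sigma> M" "\<forall>h\<in>M. (\<lambda>z. f z + h z) \<in> S"
      "LA_zero_nbhd \<sigma> N" "\<forall>h\<in>N. (\<lambda>z. f z + h z) \<in> T"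
      using S T unfolding LA_open_def by blast
    then show "\<exists>N. LA_zero_nbhd \<sigma> N \<and> (\<forall>h\<in>N. (\<lambda>z. f z + h z) \<in> S \<inter> T)"
      using LA_zero_nbhd_Int by (intro exI[of _ "M \<inter> N"]) blast
  qed
next
  fix K assume K: "\<forall>S\<in>K. LA_open \<sigma> S"
  show "LA_open \<sigma> (\<Union>K)"
    unfolding LA_open_def
  proof (intro conjI ballI)
    show "\<Union>K \<subseteq> LA \<sigma>" using K unfolding LA_open_def by blast
    fix f assume "f \<in> \<Union>K"
    then obtain S where "S \<in> K" "f \<in> S" by blast
    with K obtain N where "LA_zero_nbhd \<sigma> N" "\<forall>h\<in>N. (\<lambda>z. f z + h z) \<in> S"
      unfolding LA_open_def by blast
    with \<open>S \<in> K\<close> show "\<exists>N. LA_zero_nbhd \<sigma> N \<and> (\<forall>h\<in>N. (\<lambda>z. f z + h z) \<in> \<Union>K)"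
      by blast
  qed
qed

definition LA_dual :: "'c::{field_char_0, complete_space} set \<Rightarrow> (('c \<Rightarrow> 'c) \<Rightarrow> 'c) set"
  where "LA_dual \<sigma> = {\<mu>.
    (\<forall>f\<in>LA \<sigma>. \<forall>g\<in>LA \<sigma>. same_germ \<sigma> f g \<longrightarrow> \<mu> f = \<mu> g) \<and>
    (\<forall>f\<in>LA \<sigma>. \<forall>g\<in>LA \<sigma>. \<mu> (\<lambda>z. f z + g z) = \<mu> f + \<mu> g) \<and>
    (\<forall>c. \<forall>f\<in>LA \<sigma>. \<mu> (\<lambda>z. c * f z) = c * \<mu> f) \<and>
    continuous_map (LA_topology \<sigma>) euclidean \<mu>}"


section \<open>Support and integration\<close>

definition clopen_in :: "'c::topological_space set \<Rightarrow> 'c set \<Rightarrow> bool"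
  where "clopen_in \<sigma> U \<longleftrightarrow> openin (top_of_set \<sigma>) U \<and> closedin (top_of_set \<sigma>) U"

definition vanishes_on ::
    "'c::{field_char_0, complete_space} set \<Rightarrow> (('c \<Rightarrow> 'c) \<Rightarrow> 'c) \<Rightarrow> 'c set \<Rightarrow> bool"
  where "vanishes_on \<sigma> \<mu> U \<longleftrightarrow>
    (\<forall>f\<in>LA \<sigma>. \<forall>W. clopen_in \<sigma> W \<and> W \<subseteq> U \<and> same_germ (\<sigma> - W) f (\<lambda>_. 0) \<longrightarrow> \<mu> f = 0)"

definition supp :: "'c::{field_char_0, complete_space} set \<Rightarrow> (('c \<Rightarrow> 'c) \<Rightarrow> 'c) \<Rightarrow> 'c set"
  where "supp \<sigma> \<mu> = \<sigma> - (GREATEST U. openin (top_of_set \<sigma>) U \<and> vanishes_on \<sigma> \<mu> U)"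

text \<open>
  Here \<open>\<phi>\<close> is a partial function with domain \<open>X\<close>, locally analytic on a clopen neighbourhood
  \<open>U\<close> of the support, and \<open>g\<close> is the germ of its extension by \<open>0\<close>.
\<close>

definition has_gint :: "'c::{field_char_0, complete_space} set \<Rightarrow> (('c \<Rightarrow> 'c) \<Rightarrow> 'c) \<Rightarrow>
    'c set \<Rightarrow> ('c \<Rightarrow> 'c) \<Rightarrow> 'c \<Rightarrow> bool"
  where "has_gint \<sigma> \<mu> X \<phi> v \<longleftrightarrow>
    (\<exists>U g. clopen_in \<sigma> U \<and> supp \<sigma> \<mu> \<subseteq> U \<and> (\<exists>r>0. nbhd U r \<subseteq> X) \<and> \<phi> \<in> LA U \<and>
       g \<in> LA \<sigma> \<and> same_germ U g \<phi> \<and> same_germ (\<sigma> - U) g (\<lambda>_. 0) \<and> v = \<mu> g)"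

definition gint :: "'c::{field_char_0, complete_space} set \<Rightarrow> (('c \<Rightarrow> 'c) \<Rightarrow> 'c) \<Rightarrow>
    'c set \<Rightarrow> ('c \<Rightarrow> 'c) \<Rightarrow> 'c"
  where "gint \<sigma> \<mu> X \<phi> = (THE v. has_gint \<sigma> \<mu> X \<phi> v)"


section \<open>The zeta function of a generalized distribution\<close>

definition zeta_defined :: "nat \<Rightarrow> (rat \<Rightarrow> 'c) \<Rightarrow> 'c::{field_char_0, complete_space} set \<Rightarrow>
    (('c \<Rightarrow> 'c) \<Rightarrow> 'c) \<Rightarrow> 'c \<Rightarrow> 'c \<Rightarrow> bool"
  where "zeta_defined p ppow \<sigma> \<mu> s l \<longleftrightarrow>
    s \<noteq> 1 \<and> - l \<notin> supp \<sigma> \<mu> \<and>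
    (\<exists>!v. has_gint \<sigma> \<mu> {x. angle_pow_defined p ppow (l + x) (1 - s)}
            (\<lambda>x. angle_pow p ppow (l + x) (1 - s)) v)"

definition zeta :: "nat \<Rightarrow> (rat \<Rightarrow> 'c) \<Rightarrow> 'c::{field_char_0, complete_space} set \<Rightarrow>
    (('c \<Rightarrow> 'c) \<Rightarrow> 'c) \<Rightarrow> 'c \<Rightarrow> 'c \<Rightarrow> 'c"
  where "zeta p ppow \<sigma> \<mu> s l =
    1 / (s - 1) * gint \<sigma> \<mu> {x. angle_pow_defined p ppow (l + x) (1 - s)}
                    (\<lambda>x. angle_pow p ppow (l + x) (1 - s))"


section \<open>Regularity\<close>

text \<open>Only used for nonempty lists of pairwise distinct points.\<close>

fun diff_quot :: "('c::field \<Rightarrow> 'c) \<Rightarrow> 'c list \<Rightarrow> 'c"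
  where
    "diff_quot f [] = 0"
  | "diff_quot f [x] = f x"
  | "diff_quot f (x # y # zs) = (diff_quot f (x # zs) - diff_quot f (y # zs)) / (x - y)"

definition C_n_on :: "nat \<Rightarrow> 'c::{field_char_0, complete_space} set \<Rightarrow> ('c \<Rightarrow> 'c) \<Rightarrow> bool"
  where "C_n_on n X f \<longleftrightarrow>
    (\<exists>\<Phi>. continuous_map (product_topology (\<lambda>_. top_of_set X) {..n}) euclidean \<Phi> \<and>
      (\<forall>x \<in> (\<Pi>\<^sub>E i\<in>{..n}. X). inj_on x {..n} \<longrightarrow> \<Phi> x = diff_quot f (map x [0..<Suc n])))"

definition C_infinity_on :: "'c::{field_char_0, complete_space} set \<Rightarrow> ('c \<Rightarrow> 'c) \<Rightarrow> bool"
  where "C_infinity_on X f \<longleftrightarrow> (\<forall>n. C_n_on n X f)"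

definition locally_analytic_on :: "'c::{field_char_0, complete_space} set \<Rightarrow> ('c \<Rightarrow> 'c) \<Rightarrow> bool"
  where "locally_analytic_on \<Omega> f \<longleftrightarrow>
    (\<forall>a\<in>\<Omega>. \<exists>r>0. \<exists>c. ball a r \<subseteq> \<Omega> \<and> (\<forall>z\<in>ball a r. (\<lambda>n. c n * (z - a) ^ n) sums f z))"

end

(* Take l0 = p^(-N), so large compared with the compact set sigma that x / l0 is at least as
   small as p^2 on sigma, and let Omega be the unit ball around l0. For l in Omega and x near
   sigma the number l + x = l0 * (1 + y) with y = (x + l - l0) / l0 has omega(l + x) = l0, hence
   <l + x> = 1 + y and <l + x>^(1 - s) is the binomial series in y, with |y| <= |p|^2.
   Since |binom(1 - s, n)| <= 1 / |n!| <= p^n, everything converges geometrically, and a continuous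
   functional mu gives (s - 1) zeta(s, l) = sum_n binom(1 - s, n) m_n(l) with
   |m_n(l)| <= C |p|^(2n). Divided differences of prod_(i<n) (1 - s - i) extend continuously with
   bound 1, which yields smoothness in s; re-expanding y^n yields analyticity in l. *)

theory Submission
  imports Defs
begin

section \<open>Complete non-archimedean fields\<close>

text \<open>On the unit disc around \<open>l0\<close> all numbers l + x lie in one residue disc, so
  valuation and root of unity are constant there and the integrand is a single power series in the
  defect; closer to \<sigma> both could jump from ball to ball. The margin |p|^2 is dictated by the
  factorials: one factor |p|^n pays for 1/|n!|, the other leaves a geometric series. The same
  balance drives the re-expansions, whose coefficients again grow at most like p^k while the
  increment of \<open>l\<close> or \<open>x\<close>, divided by \<open>l0\<close>, has size at most
  |p|^2. Two obstacles are hidden in the definitions. The support refers to a greatest open set on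
  which \<mu> vanishes, and its existence has to be proved before the integral is known to be
  unique. The dual is defined by continuity for an inductive limit topology, from which an operator
  bound on the single space \<open>B 1 \<sigma>\<close> has to be extracted.\<close>

locale nonarch_field =
  fixes T :: "'c::{field_char_0, complete_space} itself"
  assumes dist_vabs: "dist x y = vabs (x - y :: 'c)"
    and vabs_mult: "vabs (x * y :: 'c) = vabs x * vabs y"
    and vabs_add_le_max: "vabs (x + y :: 'c) \<le> max (vabs x) (vabs y)"
begin

abbreviation av :: "'c \<Rightarrow> real" where "av \<equiv> vabs"

lemma vabs_zero [simp]: "av 0 = 0"
  by (simp add: vabs_def)

lemma vabs_nonneg [simp]: "av x \<ge> 0"
  by (simp add: vabs_def)

lemma vabs_eq_0_iff [simp]: "av x = 0 \<longleftrightarrow> x = 0"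
  by (simp add: vabs_def)

lemma vabs_one [simp]: "av 1 = 1"
  using vabs_mult[of 1 1] vabs_eq_0_iff[of 1] by simp

lemma vabs_minus [simp]: "av (- x) = av x"
  by (metis dist_commute dist_vabs diff_0 diff_zero)

lemma vabs_diff_le_max: "av (x - y) \<le> max (av x) (av y)"
  using vabs_add_le_max[of x "- y"] by simp

lemma vabs_minus_commute: "av (x - y) = av (y - x)"
  by (metis dist_commute dist_vabs)

lemma vabs_power: "av (x ^ n) = av x ^ n"
  by (induction n) (simp_all add: vabs_mult)

lemma vabs_inverse: "av (inverse x) = inverse (av x)"
proof (cases "x = 0")
  case False
  then have "av x * av (inverse x) = 1"
    using vabs_mult[of x "inverse x"] by simp
  then show ?thesis
    by (metis inverse_unique)
qed simp

lemma vabs_divide: "av (x / y) = av x / av y"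
  by (simp add: divide_inverse vabs_mult vabs_inverse)

lemma vabs_prod: "av (\<Prod>i\<in>A. f i) = (\<Prod>i\<in>A. av (f i))"
  by (induction A rule: infinite_finite_induct) (simp_all add: vabs_mult)

lemma vabs_sum_le:
  assumes "\<And>i. i \<in> A \<Longrightarrow> av (f i) \<le> M" "M \<ge> 0"
  shows "av (\<Sum>i\<in>A. f i) \<le> M"
  using assms
proof (induction A rule: infinite_finite_induct)
  case (insert x F)
  then have "av (f x) \<le> M" "av (sum f F) \<le> M" by auto
  with insert(1,2) vabs_add_le_max[of "f x" "sum f F"] show ?case by auto
qed auto

lemma vabs_of_nat_le_1 [simp]: "av (of_nat n) \<le> 1"
proof (induction n)
  case (Suc n)
  then show ?case using vabs_add_le_max[of 1 "of_nat n"] by simp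
qed simp

text \<open>Isosceles triangle principle: if the sum were smaller than \<open>y\<close>, then y = (x
  + y) - x would be bounded by the maximum of two smaller numbers.\<close>

lemma vabs_add_eq:
  assumes "av x < av y"
  shows "av (x + y) = av y"
proof -
  have "av (x + y) \<le> av y" using vabs_add_le_max[of x y] assms by simp
  moreover have "av y \<le> max (av (x + y)) (av x)" using vabs_diff_le_max[of "x + y" x] by simp
  ultimately show ?thesis using assms by auto
qed

section \<open>Limits and continuity under the field operations\<close>

lemma tendsto_vabs_iff: "(f \<longlongrightarrow> (l::'c)) F \<longleftrightarrow> ((\<lambda>n. av (f n - l)) \<longlongrightarrow> 0) F"
  by (subst tendsto_dist_iff) (simp add: dist_vabs)

lemma tendsto_add_vabs:
  assumes "(f \<longlongrightarrow> (a::'c)) F" "(g \<longlongrightarrow> b) F"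
  shows "((\<lambda>n. f n + g n) \<longlongrightarrow> a + b) F"
proof -
  have "((\<lambda>n. max (av (f n - a)) (av (g n - b))) \<longlongrightarrow> max 0 0) F"
    using assms unfolding tendsto_vabs_iff by (rule tendsto_max)
  then have "((\<lambda>n. max (av (f n - a)) (av (g n - b))) \<longlongrightarrow> 0) F" by simp
  moreover have "av (f n + g n - (a + b)) \<le> max (av (f n - a)) (av (g n - b))" for n
    using vabs_add_le_max[of "f n - a" "g n - b"] by (simp add: algebra_simps)
  ultimately show ?thesis
    unfolding tendsto_vabs_iff by (auto intro: Lim_null_comparison[OF always_eventually, rotated])
qed

lemma tendsto_mult_left_vabs:
  assumes "(f \<longlongrightarrow> (a::'c)) F"
  shows "((\<lambda>n. c * f n) \<longlongrightarrow> c * a) F"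
proof -
  have "((\<lambda>n. av c * av (f n - a)) \<longlongrightarrow> av c * 0) F"
    using assms unfolding tendsto_vabs_iff by (intro tendsto_intros)
  then show ?thesis
    unfolding tendsto_vabs_iff by (simp add: right_diff_distrib[symmetric] vabs_mult)
qed

lemma tendsto_mult_vabs:
  assumes "(f \<longlongrightarrow> (a::'c)) F" "(g \<longlongrightarrow> b) F"
  shows "((\<lambda>n. f n * g n) \<longlongrightarrow> a * b) F"
proof -
  have "((\<lambda>n. av (f n - a) * av (g n - b)) \<longlongrightarrow> 0 * 0) F"
    using assms unfolding tendsto_vabs_iff by (intro tendsto_intros)
  then have "((\<lambda>n. (f n - a) * (g n - b)) \<longlongrightarrow> 0) F"
    by (simp add: tendsto_vabs_iff vabs_mult)
  then have "((\<lambda>n. (f n - a) * (g n - b) + (a * g n + (b * f n + - (a * b)))) \<longlongrightarrow>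
      0 + (a * b + (b * a + - (a * b)))) F"
    using assms by (intro tendsto_add_vabs tendsto_mult_left_vabs tendsto_const)
  then show ?thesis
    by (simp add: algebra_simps)
qed

lemma tendsto_inverse_vabs:
  assumes "(f \<longlongrightarrow> (a::'c)) F" "a \<noteq> 0"
  shows "((\<lambda>n. inverse (f n)) \<longlongrightarrow> inverse a) F"
proof -
  have a: "av a > 0" using assms(2) vabs_nonneg[of a] vabs_eq_0_iff[of a] by linarith
  have "((\<lambda>n. av (f n - a) / (av a * av a)) \<longlongrightarrow> 0 / (av a * av a)) F"
    using assms a unfolding tendsto_vabs_iff by (intro tendsto_intros) auto
  moreover have "\<forall>\<^sub>F n in F. norm (av (inverse (f n) - inverse a)) \<le> av (f n - a) / (av a * av a)"
  proof -
    have "\<forall>\<^sub>F n in F. dist (f n) a < av a"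
      using assms(1) a by (rule tendstoD)
    then show ?thesis
    proof eventually_elim
      case (elim n)
      \<comment> \<open>Within distance |a| of \<open>a\<close> the absolute value is constant, so
        the denominator below has the exact size |a|^2.\<close>
      then have eq: "av (f n) = av a"
        using vabs_add_eq[of "f n - a" a] by (simp add: dist_vabs)
      then have "f n \<noteq> 0" using a by auto
      then have "inverse (f n) - inverse a = (a - f n) / (f n * a)"
        using assms(2) by (simp add: field_simps)
      then show ?case using eq by (simp add: vabs_divide vabs_mult vabs_minus_commute)
    qed
  qed
  ultimately show ?thesis
    unfolding tendsto_vabs_iff by (auto intro: Lim_null_comparison)
qed


lemma continuous_map_add_vabs:
  assumes "continuous_map X euclidean (f :: _ \<Rightarrow> 'c)" "continuous_map X euclidean g"
  shows "continuous_map X euclidean (\<lambda>x. f x + g x)"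
  using assms by (auto simp: continuous_map_atin intro: tendsto_add_vabs)

lemma continuous_map_mult_vabs:
  assumes "continuous_map X euclidean (f :: _ \<Rightarrow> 'c)" "continuous_map X euclidean g"
  shows "continuous_map X euclidean (\<lambda>x. f x * g x)"
  using assms by (auto simp: continuous_map_atin intro: tendsto_mult_vabs)

lemma continuous_map_inverse_vabs:
  assumes "continuous_map X euclidean (f :: _ \<Rightarrow> 'c)" "\<And>x. x \<in> topspace X \<Longrightarrow> f x \<noteq> 0"
  shows "continuous_map X euclidean (\<lambda>x. inverse (f x))"
  using assms by (auto simp: continuous_map_atin intro: tendsto_inverse_vabs)

lemma continuous_map_sum_vabs:
  assumes "\<And>i. i \<in> A \<Longrightarrow> continuous_map X euclidean (f i :: _ \<Rightarrow> 'c)"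
  shows "continuous_map X euclidean (\<lambda>x. \<Sum>i\<in>A. f i x)"
  using assms
  by (induction A rule: infinite_finite_induct) (auto intro: continuous_map_add_vabs)

section \<open>Series dominated by a geometric sequence\<close>

lemma sums_add_vabs: "f sums (a::'c) \<Longrightarrow> g sums b \<Longrightarrow> (\<lambda>n. f n + g n) sums (a + b)"
  unfolding sums_def by (simp add: sum.distrib tendsto_add_vabs)

lemma sums_mult_vabs: "f sums (a::'c) \<Longrightarrow> (\<lambda>n. c * f n) sums (c * a)"
  unfolding sums_def sum_distrib_left[symmetric] by (rule tendsto_mult_left_vabs)

lemma sums_diff_vabs: "f sums (a::'c) \<Longrightarrow> g sums b \<Longrightarrow> (\<lambda>n. f n - g n) sums (a - b)"
  using sums_add_vabs[of f a "\<lambda>n. (-1) * g n" "(-1) * b"] sums_mult_vabs[of g b "-1"] by simp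

text \<open>Serves to identify a sum whose value \<open>S\<close> is already at hand: the error of
  the partial sums is controlled directly, without looking at single terms.\<close>

lemma sums_geometric_bound:
  assumes "\<And>K. av (S - (\<Sum>n<K. f n)) \<le> C * \<rho> ^ K" "0 \<le> \<rho>" "\<rho> < 1"
  shows "f sums S"
proof -
  have "(\<lambda>K. C * \<rho> ^ K) \<longlonglongrightarrow> C * 0"
    using assms by (intro tendsto_intros LIMSEQ_power_zero) auto
  then have "(\<lambda>K. C * \<rho> ^ K) \<longlonglongrightarrow> 0" by simp
  moreover have "norm (av ((\<Sum>n<K. f n) - S)) \<le> C * \<rho> ^ K" for K
    using assms(1)[of K] by (simp add: vabs_minus_commute)
  ultimately show ?thesis
    unfolding sums_def tendsto_vabs_iff by (auto intro: Lim_null_comparison[OF always_eventually, rotated])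
qed

context
  fixes f :: "nat \<Rightarrow> 'c" and C \<rho> :: real
  assumes bound: "\<And>n. av (f n) \<le> C * \<rho> ^ n" and \<rho>: "0 \<le> \<rho>" "\<rho> < 1"
begin

lemma geometric_bound_nonneg: "C \<ge> 0"
  using order_trans[OF vabs_nonneg bound[of 0]] by simp

lemma vabs_partial_sum_diff_le:
  assumes "m \<le> n"
  shows "av ((\<Sum>k<n. f k) - (\<Sum>k<m. f k)) \<le> C * \<rho> ^ m"
proof -
  have "(\<Sum>k<n. f k) - (\<Sum>k<m. f k) = (\<Sum>k\<in>{m..<n}. f k)"
    using assms by (simp add: lessThan_atLeast0 sum_diff_nat_ivl)
  moreover have "av (f k) \<le> C * \<rho> ^ m" if "k \<in> {m..<n}" for k
    using bound[of k] that \<rho> geometric_bound_nonneg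
    by (auto intro!: mult_left_mono power_decreasing elim!: order_trans)
  ultimately show ?thesis
    using \<rho> geometric_bound_nonneg by (auto intro!: vabs_sum_le)
qed

lemma geometric_bound_summable: "summable f"
proof -
  have lim: "(\<lambda>K. C * \<rho> ^ K) \<longlonglongrightarrow> C * 0"
    using \<rho> by (intro tendsto_intros LIMSEQ_power_zero) auto
  have "Cauchy (\<lambda>n. \<Sum>k<n. f k)"
    unfolding Cauchy_altdef
  proof (intro allI impI)
    fix e :: real assume "e > 0"
    then obtain M where "\<And>m. m \<ge> M \<Longrightarrow> C * \<rho> ^ m < e"
      using order_tendstoD(2)[OF lim] by (auto simp: eventually_sequentially)
    then have "dist (\<Sum>k<m. f k) (\<Sum>k<n. f k) < e" if "m \<ge> M" "n > m" for m n
      using order_le_less_trans[OF vabs_partial_sum_diff_le[of m n]] that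
      by (simp add: dist_vabs vabs_minus_commute)
    then show "\<exists>M. \<forall>m\<ge>M. \<forall>n>m. dist (\<Sum>k<m. f k) (\<Sum>k<n. f k) < e"
      by blast
  qed
  then show ?thesis
    by (simp add: summable_iff_convergent Cauchy_convergent_iff)
qed

text \<open>An ultrametric tail is bounded like its first term, hence the constant \<open>C\<close>
  without the factor 1 / (1 - \<rho>) of the real case.\<close>

lemma vabs_suminf_tail_le: "av (suminf f - (\<Sum>n<K. f n)) \<le> C * \<rho> ^ K"
proof (rule tendsto_upperbound)
  have "(\<lambda>n. \<Sum>k<n. f k) \<longlonglongrightarrow> suminf f"
    using geometric_bound_summable summable_LIMSEQ by blast
  then have "(\<lambda>n. dist (\<Sum>k<n. f k) (\<Sum>k<K. f k)) \<longlonglongrightarrow> dist (suminf f) (\<Sum>k<K. f k)"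
    by (intro tendsto_intros)
  then show "(\<lambda>n. av ((\<Sum>k<n. f k) - (\<Sum>k<K. f k))) \<longlonglongrightarrow> av (suminf f - (\<Sum>k<K. f k))"
    by (simp add: dist_vabs)
  show "\<forall>\<^sub>F n in sequentially. av ((\<Sum>k<n. f k) - (\<Sum>k<K. f k)) \<le> C * \<rho> ^ K"
    using eventually_ge_at_top[of K] by eventually_elim (rule vabs_partial_sum_diff_le)
qed auto

end

text \<open>Summation by rows against summation by diagonals. The triangle k + j < K is common to
  the first K diagonals and the first K rows; what remains is a tail of the diagonal series and one
  tail in each row, all of size at most C \<rho>^K.\<close>

lemma sums_double:
  fixes A :: "nat \<Rightarrow> nat \<Rightarrow> 'c"
  assumes bound: "\<And>k j. av (A k j) \<le> C * \<rho> ^ (k + j)" and \<rho>: "0 \<le> \<rho>" "\<rho> < 1"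
  shows "(\<lambda>k. suminf (A k)) sums (\<Sum>n. \<Sum>k\<le>n. A k (n - k))"
proof (rule sums_geometric_bound)
  let ?D = "\<lambda>n. \<Sum>k\<le>n. A k (n - k)"
  fix K
  have C: "C \<ge> 0" using order_trans[OF vabs_nonneg bound[of 0 0]] by simp
  have D: "av (?D n) \<le> C * \<rho> ^ n" for n
  proof (rule vabs_sum_le)
    show "av (A i (n - i)) \<le> C * \<rho> ^ n" if "i \<in> {..n}" for i
      using bound[of i "n - i"] that by simp
  qed (use C \<rho> in auto)
  have row: "av (suminf (A k) - (\<Sum>j<K - k. A k j)) \<le> C * \<rho> ^ K" if "k < K" for k
  proof -
    have "av (A k j) \<le> (C * \<rho> ^ k) * \<rho> ^ j" for j
      using bound[of k j] by (simp add: power_add mult.assoc)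
    from vabs_suminf_tail_le[OF this \<rho>, of "K - k"] show ?thesis
      using that by (simp add: power_add[symmetric] mult.assoc)
  qed
  have "{(i, j). i + j < K} = (SIGMA i:{..<K}. {..<K - i})" by auto
  then have tri: "(\<Sum>n<K. ?D n) = (\<Sum>k<K. \<Sum>j<K - k. A k j)"
    unfolding sum.triangle_reindex[symmetric] by (simp add: sum.Sigma)
  have "suminf ?D - (\<Sum>k<K. suminf (A k)) =
      (suminf ?D - (\<Sum>n<K. ?D n)) - (\<Sum>k<K. suminf (A k) - (\<Sum>j<K - k. A k j))"
    unfolding tri sum_subtractf by simp
  moreover have "av (suminf ?D - (\<Sum>n<K. ?D n)) \<le> C * \<rho> ^ K"
    using vabs_suminf_tail_le[of ?D, OF D \<rho>] .
  moreover have "av (\<Sum>k<K. suminf (A k) - (\<Sum>j<K - k. A k j)) \<le> C * \<rho> ^ K"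
    using row C \<rho> by (intro vabs_sum_le) auto
  ultimately show "av (suminf ?D - (\<Sum>k<K. suminf (A k))) \<le> C * \<rho> ^ K"
    using vabs_diff_le_max by (smt (verit))
qed (use \<rho> in auto)

text \<open>The Weierstrass test, over an arbitrary topological space because extended divided
  differences are functions on finite powers of a set.\<close>

lemma continuous_map_suminf_vabs:
  fixes f :: "nat \<Rightarrow> 'a \<Rightarrow> 'c"
  assumes cont: "\<And>n. continuous_map X euclidean (f n)"
    and bound: "\<And>n x. x \<in> topspace X \<Longrightarrow> av (f n x) \<le> C * \<rho> ^ n"
    and \<rho>: "0 \<le> \<rho>" "\<rho> < 1"
  shows "continuous_map X euclidean (\<lambda>x. \<Sum>n. f n x)"
proof -
  have "continuous_map X Met_TC.mtopology (\<lambda>x. \<Sum>n. f n x)"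
  proof (rule Met_TC.continuous_map_uniform_limit)
    show "\<forall>\<^sub>F K in sequentially. continuous_map X Met_TC.mtopology (\<lambda>x. \<Sum>n<K. f n x)"
      using cont by (auto intro!: always_eventually continuous_map_sum_vabs)
    fix e :: real assume "e > 0"
    have lim: "(\<lambda>K. C * \<rho> ^ K) \<longlonglongrightarrow> C * 0"
      using \<rho> by (intro tendsto_intros LIMSEQ_power_zero) auto
    have "\<forall>\<^sub>F K in sequentially. C * \<rho> ^ K < e"
      using order_tendstoD(2)[OF lim] \<open>e > 0\<close> by simp
    then show "\<forall>\<^sub>F K in sequentially. \<forall>x\<in>topspace X.
        (\<Sum>n. f n x) \<in> UNIV \<and> dist (\<Sum>n<K. f n x) (\<Sum>n. f n x) < e"
    proof eventually_elim
      case (elim K)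
      show ?case
        using vabs_suminf_tail_le[OF bound \<rho>, of _ K] elim
        by (force simp: dist_vabs vabs_minus_commute)
    qed
  qed simp
  then show ?thesis by simp
qed

section \<open>Divided differences of series and of products with a linear factor\<close>

lemma diff_quot_cong:
  assumes "\<And>x. x \<in> set xs \<Longrightarrow> f x = g x"
  shows "diff_quot f xs = (diff_quot g xs :: 'c)"
  using assms by (induction f xs rule: diff_quot.induct) auto

lemma diff_quot_const: "diff_quot (\<lambda>_. c :: 'c) (x # y # zs) = 0"
proof (induction zs arbitrary: x y)
  case (Cons w zs)
  show ?case
    by (subst diff_quot.simps(3)) (simp only: Cons.IH diff_self div_0)
qed simp

lemma diff_quot_sums:
  assumes "\<And>x. x \<in> set xs \<Longrightarrow> (\<lambda>n. f n x) sums (F x :: 'c)"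
  shows "(\<lambda>n. diff_quot (f n) xs) sums diff_quot F xs"
  using assms
proof (induction F xs rule: diff_quot.induct)
  case (3 F x y zs)
  then have "(\<lambda>n. diff_quot (f n) (x # zs) - diff_quot (f n) (y # zs)) sums
      (diff_quot F (x # zs) - diff_quot F (y # zs))"
    by (intro sums_diff_vabs) auto
  from sums_mult_vabs[OF this, of "inverse (x - y)"] show ?case
    by (simp add: field_simps)
qed auto

text \<open>Leibniz rule for divided differences. A linear factor has only two that do not vanish,
  its value at the first node and its slope 1, so two terms survive. Solved for the divided
  difference of \<open>f\<close>, the rule also handles division by s - c.\<close>

lemma diff_quot_mult_linear:
  assumes "distinct (x # y # zs)"
  shows "diff_quot (\<lambda>s. (s - c) * f s) (x # y # zs) =
    (x - c) * diff_quot f (x # y # zs) + diff_quot f (y # zs :: 'c list)"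
  using assms
proof (induction zs arbitrary: x y)
  case Nil
  then show ?case by (simp add: field_simps)
next
  case (Cons w zs)
  have "x \<noteq> y" using Cons.prems by auto
  moreover have "diff_quot (\<lambda>s. (s - c) * f s) (x # w # zs) =
      (x - c) * diff_quot f (x # w # zs) + diff_quot f (w # zs)"
    using Cons.prems by (intro Cons.IH) auto
  moreover have "diff_quot (\<lambda>s. (s - c) * f s) (y # w # zs) =
      (y - c) * diff_quot f (y # w # zs) + diff_quot f (w # zs)"
    using Cons.prems by (intro Cons.IH) auto
  \<comment> \<open>Here \<open>u\<close>, \<open>v\<close> and the bound \<open>w\<close> stand for
    the divided differences of \<open>f\<close> on \<open>x # w # zs\<close>,
    \<open>y # w # zs\<close> and \<open>w # zs\<close>; the last one cancels.\<close>
  moreover have "((x - c) * u + w - ((y - c) * v + w)) / (x - y) = (x - c) * ((u - v) / (x - y)) + v"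
    if "x \<noteq> y" for u v w
    using that by (simp add: field_simps)
  ultimately show ?case
    by (simp only: diff_quot.simps(3)[of _ x y "w # zs"] simp_thms)
qed

section \<open>Extending divided differences\<close>

lemma C_n_on_cong:
  assumes "\<And>x. x \<in> X \<Longrightarrow> f x = (g x :: 'c)"
  shows "C_n_on n X f \<longleftrightarrow> C_n_on n X g"
proof -
  have "diff_quot f (map x [0..<Suc n]) = diff_quot g (map x [0..<Suc n])"
    if "x \<in> (\<Pi>\<^sub>E i\<in>{..n}. X)" for x
    using that assms by (intro diff_quot_cong) (fastforce simp: PiE_iff)
  then show ?thesis
    unfolding C_n_on_def by (intro ex_cong1 conj_cong ball_cong refl) simp
qed

text \<open>The restriction makes the remaining nodes an extensional tuple, as the points of the
  product over \<open>{..n}\<close> have to be.\<close>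

definition shift :: "nat \<Rightarrow> (nat \<Rightarrow> 'c) \<Rightarrow> nat \<Rightarrow> 'c"
  where "shift n x = restrict (\<lambda>i. x (Suc i)) {..n}"

lemma shift_PiE: "x \<in> (\<Pi>\<^sub>E i\<in>{..Suc n}. X) \<Longrightarrow> shift n x \<in> (\<Pi>\<^sub>E i\<in>{..n}. X)"
  by (auto simp: shift_def)

lemma inj_on_shift: "inj_on x {..Suc n} \<Longrightarrow> inj_on (shift n x) {..n}"
  by (auto simp: shift_def inj_on_def)

lemma map_shift: "map x [0..<Suc (Suc n)] = x 0 # map (shift n x) [0..<Suc n]"
  by (subst map_upt_Suc) (auto simp: shift_def simp del: upt_Suc)

lemma continuous_map_shift:
  "continuous_map (product_topology (\<lambda>_. top_of_set X) {..Suc n})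
     (product_topology (\<lambda>_. top_of_set X) {..n}) (shift n)"
  unfolding continuous_map_componentwise
proof (intro conjI ballI)
  show "shift n ` topspace (product_topology (\<lambda>_. top_of_set X) {..Suc n}) \<subseteq> extensional {..n}"
    by (auto simp: shift_def)
  show "continuous_map (product_topology (\<lambda>_. top_of_set X) {..Suc n}) (top_of_set X)
      (\<lambda>x. shift n x k)" if "k \<in> {..n}" for k
    using that continuous_map_product_projection[of "Suc k" "{..Suc n}" "\<lambda>_. top_of_set X"]
    by (simp add: shift_def)
qed

lemma continuous_map_component:
  "i \<le> n \<Longrightarrow> continuous_map (product_topology (\<lambda>_. top_of_set X) {..n}) euclidean (\<lambda>x. x i :: 'c)"
  using continuous_map_product_projection[of i "{..n}" "\<lambda>_. top_of_set X"]
  by (simp add: continuous_map_in_subtopology)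

lemma diff_quot_mult_linear_shift:
  assumes "inj_on x {..Suc n}"
  shows "diff_quot (\<lambda>s. (s - c) * f s) (map x [0..<Suc (Suc n)]) =
    (x 0 - c) * diff_quot f (map x [0..<Suc (Suc n)]) + diff_quot f (map (shift n x) [0..<Suc n])"
proof -
  obtain y zs where ys: "map (shift n x) [0..<Suc n] = y # zs"
    using map_upt_Suc by blast
  have "distinct (map x [0..<Suc (Suc n)])"
    using assms by (auto simp: distinct_map inj_on_def simp del: upt_Suc)
  then show ?thesis
    unfolding map_shift ys by (rule diff_quot_mult_linear)
qed

text \<open>With g = f / (s - c), the Leibniz rule for f = (s - c) g is solved for the divided
  difference of g, which is possible because \<open>x 0 - c\<close> never vanishes. The lower order
  term is the extension from the induction hypothesis, composed with \<open>shift\<close>.\<close>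

lemma C_n_on_divide_linear:
  assumes "C_infinity_on X f" "(c :: 'c) \<notin> X"
  shows "C_n_on n X (\<lambda>s. f s / (s - c))"
proof (induction n)
  let ?X = "\<lambda>n. product_topology (\<lambda>_. top_of_set X) {..n::nat}"
  have inv: "continuous_map (?X n) euclidean (\<lambda>x. inverse (x 0 - c))" for n
  proof (rule continuous_map_inverse_vabs)
    show "continuous_map (?X n) euclidean (\<lambda>x. x 0 - c)"
      using continuous_map_add_vabs[OF continuous_map_component[of 0 n X], of "\<lambda>_. - c"] by simp
  qed (use assms(2) in auto)
  {
    case 0
    obtain \<Phi> where \<Phi>: "continuous_map (?X 0) euclidean \<Phi>"
      "\<And>x. x \<in> (\<Pi>\<^sub>E i\<in>{..0}. X) \<Longrightarrow> \<Phi> x = f (x 0)"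
      using assms(1) unfolding C_infinity_on_def C_n_on_def by (force dest: spec[of _ 0])
    show ?case
      unfolding C_n_on_def
      using \<Phi> by (intro exI[of _ "\<lambda>x. \<Phi> x * inverse (x 0 - c)"] conjI continuous_map_mult_vabs inv)
        (simp_all add: field_simps)
  next
    case (Suc n)
    obtain \<Phi> where \<Phi>: "continuous_map (?X (Suc n)) euclidean \<Phi>"
      "\<And>x. x \<in> (\<Pi>\<^sub>E i\<in>{..Suc n}. X) \<Longrightarrow> inj_on x {..Suc n} \<Longrightarrow>
        \<Phi> x = diff_quot f (map x [0..<Suc (Suc n)])"
      using assms(1) unfolding C_infinity_on_def C_n_on_def by meson
    obtain \<Psi> where \<Psi>: "continuous_map (?X n) euclidean \<Psi>"
      "\<And>x. x \<in> (\<Pi>\<^sub>E i\<in>{..n}. X) \<Longrightarrow> inj_on x {..n} \<Longrightarrow>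
        \<Psi> x = diff_quot (\<lambda>s. f s / (s - c)) (map x [0..<Suc n])"
      using Suc unfolding C_n_on_def by meson
    let ?\<Theta> = "\<lambda>x. (\<Phi> x + (-1) * \<Psi> (shift n x)) * inverse (x 0 - c)"
    have "continuous_map (?X (Suc n)) euclidean ?\<Theta>"
      using continuous_map_compose[OF continuous_map_shift \<Psi>(1)] \<Phi>(1)
      by (intro continuous_map_mult_vabs continuous_map_add_vabs inv) (simp_all add: o_def)
    moreover have "?\<Theta> x = diff_quot (\<lambda>s. f s / (s - c)) (map x [0..<Suc (Suc n)])"
      if x: "x \<in> (\<Pi>\<^sub>E i\<in>{..Suc n}. X)" "inj_on x {..Suc n}" for x
    proof -
      let ?g = "\<lambda>s. f s / (s - c)"
      have "x 0 - c \<noteq> 0" using x(1) assms(2) by auto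
      have "\<Phi> x = diff_quot (\<lambda>s. (s - c) * ?g s) (map x [0..<Suc (Suc n)])"
        unfolding \<Phi>(2)[OF x]
        using x(1) assms(2) by (intro diff_quot_cong) (auto simp: PiE_iff simp del: upt_Suc)
      also have "\<dots> = (x 0 - c) * diff_quot ?g (map x [0..<Suc (Suc n)]) + \<Psi> (shift n x)"
        using x by (simp only: diff_quot_mult_linear_shift \<Psi>(2) shift_PiE inj_on_shift)
      finally have "\<Phi> x + (-1) * \<Psi> (shift n x) = (x 0 - c) * diff_quot ?g (map x [0..<Suc (Suc n)])"
        by simp
      with \<open>x 0 - c \<noteq> 0\<close> show ?thesis
        by (simp del: upt_Suc)
    qed
    ultimately show ?case
      unfolding C_n_on_def by (intro exI[of _ ?\<Theta>]) blast
  }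
qed

text \<open>The bound is asked of the extension on all tuples: off the injective ones
  \<open>\<Phi>\<close> need not be determined by \<open>f\<close>, and summing the extensions of a
  series takes a uniform bound.\<close>

definition bounded_C_n_on :: "nat \<Rightarrow> 'c set \<Rightarrow> real \<Rightarrow> ('c \<Rightarrow> 'c) \<Rightarrow> bool"
  where "bounded_C_n_on n X b f \<longleftrightarrow>
    (\<exists>\<Phi>. continuous_map (product_topology (\<lambda>_. top_of_set X) {..n}) euclidean \<Phi> \<and>
      (\<forall>x \<in> (\<Pi>\<^sub>E i\<in>{..n}. X). av (\<Phi> x) \<le> b) \<and>
      (\<forall>x \<in> (\<Pi>\<^sub>E i\<in>{..n}. X). inj_on x {..n} \<longrightarrow> \<Phi> x = diff_quot f (map x [0..<Suc n])))"

lemma bounded_C_n_on_one: "bounded_C_n_on n X 1 (\<lambda>_. 1)"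
proof (cases n)
  case 0
  then show ?thesis
    unfolding bounded_C_n_on_def by (intro exI[of _ "\<lambda>_. 1"]) simp
next
  case (Suc m)
  have "diff_quot (\<lambda>_. 1 :: 'c) (map x [0..<Suc n]) = 0" for x
    unfolding Suc map_upt_Suc by (rule diff_quot_const)
  then show ?thesis
    unfolding bounded_C_n_on_def by (intro exI[of _ "\<lambda>_. 0"]) simp
qed

text \<open>Both terms of the Leibniz rule are at most \<open>b\<close>, and so is their sum by the
  ultrametric inequality; products of arbitrarily many such factors thus keep one bound. All orders
  of \<open>f\<close> are assumed because order n calls on order n - 1.\<close>

lemma bounded_C_n_on_mult_linear:
  assumes f: "\<And>n. bounded_C_n_on n X b f" and c: "\<And>x. x \<in> X \<Longrightarrow> av (x - c) \<le> 1" and "b \<ge> 0"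
  shows "bounded_C_n_on n X b (\<lambda>s. (s - c) * f s)"
proof -
  let ?X = "\<lambda>n. product_topology (\<lambda>_. top_of_set X) {..n::nat}"
  have lin: "continuous_map (?X n) euclidean (\<lambda>x. x 0 + (- c))" for n
    by (intro continuous_map_add_vabs continuous_map_component) auto
  have bd: "av ((x 0 + (- c)) * y) \<le> b"
    if "x \<in> (\<Pi>\<^sub>E i\<in>{..n}. X)" "av y \<le> b" for x y and n :: nat
    using mult_mono[OF c[of "x 0"] that(2)] that(1) by (auto simp: vabs_mult)
  obtain \<Phi> where \<Phi>: "continuous_map (?X n) euclidean \<Phi>"
    "\<And>x. x \<in> (\<Pi>\<^sub>E i\<in>{..n}. X) \<Longrightarrow> av (\<Phi> x) \<le> b"
    "\<And>x. x \<in> (\<Pi>\<^sub>E i\<in>{..n}. X) \<Longrightarrow> inj_on x {..n} \<Longrightarrow> \<Phi> x = diff_quot f (map x [0..<Suc n])"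
    using f[of n] unfolding bounded_C_n_on_def by meson
  show ?thesis
  proof (cases n)
    case 0
    show ?thesis
      unfolding bounded_C_n_on_def
    proof (intro exI[of _ "\<lambda>x. (x 0 + (- c)) * \<Phi> x"] conjI ballI impI)
      show "continuous_map (?X n) euclidean (\<lambda>x. (x 0 + (- c)) * \<Phi> x)"
        by (intro continuous_map_mult_vabs lin \<Phi>)
      show "av ((x 0 + (- c)) * \<Phi> x) \<le> b" if "x \<in> (\<Pi>\<^sub>E i\<in>{..n}. X)" for x
        using bd \<Phi>(2) that by blast
    qed (use \<Phi>(3) 0 in auto)
  next
    case (Suc m)
    obtain \<Psi> where \<Psi>: "continuous_map (?X m) euclidean \<Psi>"
      "\<And>x. x \<in> (\<Pi>\<^sub>E i\<in>{..m}. X) \<Longrightarrow> av (\<Psi> x) \<le> b"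
      "\<And>x. x \<in> (\<Pi>\<^sub>E i\<in>{..m}. X) \<Longrightarrow> inj_on x {..m} \<Longrightarrow> \<Psi> x = diff_quot f (map x [0..<Suc m])"
      using f[of m] unfolding bounded_C_n_on_def by meson
    let ?\<Theta> = "\<lambda>x. (x 0 + (- c)) * \<Phi> x + \<Psi> (shift m x)"
    have "continuous_map (?X n) euclidean ?\<Theta>"
      using continuous_map_compose[OF continuous_map_shift \<Psi>(1)]
      by (intro continuous_map_add_vabs continuous_map_mult_vabs lin \<Phi>) (simp_all add: o_def Suc)
    moreover have "av (?\<Theta> x) \<le> b" if x: "x \<in> (\<Pi>\<^sub>E i\<in>{..n}. X)" for x
    proof -
      have "av ((x 0 + (- c)) * \<Phi> x) \<le> b" using bd \<Phi>(2) x by blast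
      moreover have "av (\<Psi> (shift m x)) \<le> b" using \<Psi>(2) shift_PiE x Suc by blast
      ultimately show ?thesis using vabs_add_le_max by (smt (verit))
    qed
    moreover have "?\<Theta> x = diff_quot (\<lambda>s. (s - c) * f s) (map x [0..<Suc n])"
      if x: "x \<in> (\<Pi>\<^sub>E i\<in>{..n}. X)" "inj_on x {..n}" for x
    proof -
      note x' = x[unfolded Suc]
      have "diff_quot (\<lambda>s. (s - c) * f s) (map x [0..<Suc n]) =
          (x 0 - c) * \<Phi> x + \<Psi> (shift m x)"
        unfolding Suc diff_quot_mult_linear_shift[OF x'(2)]
        by (simp only: \<Phi>(3)[OF x, unfolded Suc] \<Psi>(3)[OF shift_PiE[OF x'(1)] inj_on_shift[OF x'(2)]])
      then show ?thesis by simp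
    qed
    ultimately show ?thesis
      unfolding bounded_C_n_on_def by (intro exI[of _ ?\<Theta>]) blast
  qed
qed

text \<open>The extensions of the \<open>f k\<close> are summed by the Weierstrass test; at
  injective tuples the sum is right because divided differences commute with convergent
  series.\<close>

lemma C_n_on_series:
  assumes f: "\<And>k. bounded_C_n_on n X (b k) (f k)"
    and sums: "\<And>s. s \<in> X \<Longrightarrow> (\<lambda>k. m k * f k s) sums F s"
    and bound: "\<And>k. av (m k) * b k \<le> C * \<rho> ^ k" and \<rho>: "0 \<le> \<rho>" "\<rho> < 1"
  shows "C_n_on n X F"
proof -
  let ?X = "product_topology (\<lambda>_. top_of_set X) {..n}"
  obtain \<Phi> where \<Phi>: "\<And>k. continuous_map ?X euclidean (\<Phi> k)"
    "\<And>k x. x \<in> (\<Pi>\<^sub>E i\<in>{..n}. X) \<Longrightarrow> av (\<Phi> k x) \<le> b k"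
    "\<And>k x. x \<in> (\<Pi>\<^sub>E i\<in>{..n}. X) \<Longrightarrow> inj_on x {..n} \<Longrightarrow> \<Phi> k x = diff_quot (f k) (map x [0..<Suc n])"
    using f unfolding bounded_C_n_on_def by metis
  let ?\<Theta> = "\<lambda>x. \<Sum>k. m k * \<Phi> k x"
  have "continuous_map ?X euclidean ?\<Theta>"
  proof (rule continuous_map_suminf_vabs[OF _ _ \<rho>])
    show "continuous_map ?X euclidean (\<lambda>x. m k * \<Phi> k x)" for k
      by (intro continuous_map_mult_vabs \<Phi>) auto
    fix k x assume "x \<in> topspace ?X"
    then have "av (\<Phi> k x) \<le> b k" using \<Phi>(2) by simp
    then have "av (m k * \<Phi> k x) \<le> av (m k) * b k"
      by (simp add: vabs_mult mult_left_mono)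
    also note bound
    finally show "av (m k * \<Phi> k x) \<le> C * \<rho> ^ k" .
  qed
  moreover have "?\<Theta> x = diff_quot F (map x [0..<Suc n])"
    if x: "x \<in> (\<Pi>\<^sub>E i\<in>{..n}. X)" "inj_on x {..n}" for x
  proof -
    have scale: "diff_quot (\<lambda>s. a * g s) xs = a * diff_quot g xs" for a :: 'c and g xs
      by (induction g xs rule: diff_quot.induct) (simp_all add: right_diff_distrib[symmetric])
    have "(\<lambda>k. diff_quot (\<lambda>s. m k * f k s) (map x [0..<Suc n])) sums diff_quot F (map x [0..<Suc n])"
      using sums x(1) by (intro diff_quot_sums) (fastforce simp: PiE_iff)
    then show ?thesis
      unfolding scale \<Phi>(3)[OF x, symmetric] by (rule sums_unique[symmetric])
  qed
  ultimately show ?thesis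
    unfolding C_n_on_def by (intro exI[of _ ?\<Theta>]) blast
qed

end

section \<open>Binomial series over the $p$-adic complex numbers\<close>

locale padic_field = nonarch_field T
  for T :: "'c::{field_char_0, complete_space} itself" +
  fixes p :: nat
  assumes prime_p: "prime p" and vabs_p: "vabs (of_nat p :: 'c) = 1 / real p"
begin

section \<open>Absolute values of integers, factorials and binomial coefficients\<close>

lemma real_p_gt_1: "real p > 1"
  using prime_gt_1_nat[OF prime_p] by simp

lemma inverse_p_range: "0 < 1 / real p" "1 / real p < 1"
  using real_p_gt_1 by simp_all

text \<open>The balance behind all estimates: growth p^n of the coefficients against powers of an
  argument of size at most p^(-2).\<close>

lemma inverse_p_cancel: "real p ^ n * (1 / real p) ^ (2 * n) = (1 / real p) ^ n"
  using real_p_gt_1 by (simp add: power_mult power2_eq_square power_mult_distrib[symmetric])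

text \<open>In a Bezout relation u p + v n = 1 the first term has absolute value below 1, so the
  second must reach 1.\<close>

lemma vabs_of_nat_not_dvd:
  assumes "\<not> p dvd n"
  shows "av (of_nat n) = 1"
proof -
  have "gcd (int p) (int n) = 1"
    using prime_imp_coprime[OF prime_p assms] by (simp add: coprime_iff_gcd_eq_1)
  then obtain u v where "u * int p + v * int n = 1"
    using bezout_int[of "int p" "int n"] by auto
  then have eq: "of_int u * of_nat p + of_int v * of_nat n = (1 :: 'c)"
    by (metis of_int_1 of_int_add of_int_mult of_int_of_nat_eq)
  have int: "av (of_int k) \<le> 1" for k
    by (cases k) (simp_all del: of_nat_Suc)
  have "1 \<le> max (av (of_int u) * (1 / real p)) (av (of_int v) * av (of_nat n))"
    using vabs_add_le_max[of "of_int u * of_nat p" "of_int v * of_nat n"]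
    unfolding eq by (simp add: vabs_mult vabs_p)
  moreover have "av (of_int u) * (1 / real p) < 1"
    using mult_right_mono[OF int[of u], of "1 / real p"] inverse_p_range by linarith
  moreover have "av (of_int v) * av (of_nat n) \<le> av (of_nat n)"
    using mult_right_mono[OF int[of v], of "av (of_nat n)"] by simp
  ultimately show ?thesis
    using vabs_of_nat_le_1[of n] by linarith
qed

lemma vabs_fact_eq: "av (fact n) = (\<Prod>k\<in>{1..n}. av (of_nat k))"
  unfolding fact_prod of_nat_prod by (rule vabs_prod)

text \<open>Only the multiples of p up to n contribute, which gives |n!| = p^(-q) |q!| with q = n
  div p. By induction this is at least p^(-2q), and 2q \<le> n since p \<ge> 2.\<close>

lemma vabs_fact_ge: "(1 / real p) ^ n \<le> av (fact n)"
proof (induction n rule: less_induct)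
  case (less n)
  show ?case
  proof (cases "n = 0")
    case False
    let ?q = "n div p"
    have p2: "p \<ge> 2" using prime_ge_2_nat[OF prime_p] .
    have "p * ?q \<le> n" by (rule times_div_less_eq_dividend)
    then have le: "2 * ?q \<le> n"
      using mult_le_mono1[OF p2, of ?q] by linarith
    have "k \<in> (\<lambda>j. p * j) ` {1..?q}" if "k \<in> {1..n}" "p dvd k" for k
    proof -
      obtain j where "k = p * j" using \<open>p dvd k\<close> by blast
      with that p2 show ?thesis
        using div_le_mono[of k n p] by auto
    qed
    then have multiples: "{k \<in> {1..n}. p dvd k} = (\<lambda>j. p * j) ` {1..?q}"
      using p2 order_trans[OF mult_le_mono2 \<open>p * ?q \<le> n\<close>] by (fastforce simp: Suc_le_eq)
    have "av (fact n) = (\<Prod>k\<in>{k \<in> {1..n}. p dvd k}. av (of_nat k))"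
      unfolding vabs_fact_eq using vabs_of_nat_not_dvd by (intro prod.mono_neutral_right) auto
    also have "\<dots> = (\<Prod>j\<in>{1..?q}. av (of_nat (p * j)))"
      unfolding multiples using p2 by (subst prod.reindex) (auto intro: inj_onI)
    also have "\<dots> = (1 / real p) ^ ?q * av (fact ?q)"
      unfolding vabs_fact_eq of_nat_mult vabs_mult vabs_p prod.distrib by simp
    finally have "av (fact n) = (1 / real p) ^ ?q * av (fact ?q)" .
    also have "\<dots> \<ge> (1 / real p) ^ ?q * (1 / real p) ^ ?q"
      using less.IH[of ?q] False p2 inverse_p_range by (intro mult_left_mono) auto
    finally have "(1 / real p) ^ (2 * ?q) \<le> av (fact n)"
      by (simp add: mult_2 power_add)
    moreover have "(1 / real p) ^ n \<le> (1 / real p) ^ (2 * ?q)"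
      using inverse_p_range le by (intro power_decreasing) auto
    ultimately show ?thesis by linarith
  qed simp
qed

lemma inverse_vabs_fact_le: "inverse (av (fact n)) \<le> real p ^ n"
  using le_imp_inverse_le[OF vabs_fact_ge[of n]] real_p_gt_1
  by (simp add: power_one_over)

text \<open>The numerator is a product of factors of size at most 1, so 1 / n! accounts for all the
  growth. The bound 1, valid for p-adic integers, fails on the unit disc treated here.\<close>

lemma vabs_gbinomial_le:
  assumes "av t \<le> 1"
  shows "av (t gchoose n) \<le> real p ^ n"
proof -
  have "av (t - of_nat i) \<le> 1" for i
    using vabs_diff_le_max[of t "of_nat i"] vabs_of_nat_le_1[of i] assms by linarith
  then have "av (\<Prod>i = 0..<n. t - of_nat i) \<le> 1"
    unfolding vabs_prod by (intro prod_le_1) auto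
  then have "av (t gchoose n) \<le> 1 * inverse (av (fact n))"
    unfolding gbinomial_prod_rev divide_inverse vabs_mult vabs_inverse
    by (intro mult_right_mono) auto
  then show ?thesis using inverse_vabs_fact_le[of n] by linarith
qed

text \<open>Up to sign and 1 / k! the binomial coefficient of 1 - s is a product of factors s - (1 -
  i), each of size at most 1 on \<open>X\<close>, so its divided differences extend with bound 1.
  The factor 1 / k! is moved into the coefficients, where it uses up half of the decay
  p^(-2k).\<close>

lemma C_n_on_binomial_series:
  assumes m: "\<And>k. av (m k) \<le> C * (1 / real p) ^ (2 * k)"
    and X: "\<And>s. s \<in> X \<Longrightarrow> av s \<le> 1"
    and sums: "\<And>s. s \<in> X \<Longrightarrow> (\<lambda>k. m k * ((1 - s) gchoose k)) sums F s"
  shows "C_n_on n X F"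
proof -
  let ?f = "\<lambda>k s. \<Prod>i<k. s - (1 - of_nat i) :: 'c"
  let ?m = "\<lambda>k. m k * ((-1) ^ k / fact k)"
  have "(\<Prod>i = 0..<k. 1 - s - of_nat i) = (-1) ^ k * ?f k s" for s k
    by (induction k) (simp_all add: algebra_simps)
  then have gb: "m k * ((1 - s) gchoose k) = ?m k * ?f k s" for s k
    by (simp add: gbinomial_prod_rev)
  have "bounded_C_n_on n X 1 (?f k)" for n k
  proof (induction k arbitrary: n)
    case 0
    then show ?case by (simp add: bounded_C_n_on_one)
  next
    case (Suc k)
    have "av (s - (1 - of_nat k)) \<le> 1" if "s \<in> X" for s
      using vabs_diff_le_max[of s "1 - of_nat k"] vabs_diff_le_max[of 1 "of_nat k"]
        vabs_of_nat_le_1[of k] X[OF that] by simp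
    from bounded_C_n_on_mult_linear[OF Suc this] show ?case
      by (simp add: mult.commute)
  qed
  moreover have "av (?m k) * 1 \<le> C * (1 / real p) ^ k" for k
  proof -
    have "av (?m k) = av (m k) * inverse (av (fact k))"
      by (simp add: vabs_mult vabs_power vabs_inverse divide_inverse)
    also have "\<dots> \<le> (C * (1 / real p) ^ (2 * k)) * real p ^ k"
      using m[of k] inverse_vabs_fact_le[of k] order_trans[OF vabs_nonneg m[of k]]
      by (intro mult_mono) auto
    also have "\<dots> = C * (real p ^ k * (1 / real p) ^ (2 * k))"
      by (simp only: mult_ac)
    finally show ?thesis unfolding inverse_p_cancel by simp
  qed
  ultimately show ?thesis
    using C_n_on_series[of n X "\<lambda>_. 1" ?f ?m F C "1 / real p"] sums inverse_p_range
    unfolding gb by simp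
qed

text \<open>With \<open>e j = y ^ j\<close> the inner sum is \<open>(z + y) ^ n\<close>, so this re-expands a power series
  around another point; with \<open>e\<close> a moment sequence it does so under an integral.\<close>

lemma binomial_reexpand:
  fixes b e :: "nat \<Rightarrow> 'c"
  assumes b: "\<And>n. av (b n) \<le> real p ^ n" and e: "\<And>j. av (e j) \<le> C * (1 / real p) ^ (2 * j)"
  shows "\<exists>c. \<forall>z. av z \<le> (1 / real p) ^ 2 \<longrightarrow>
    (\<lambda>k. c k * z ^ k) sums (\<Sum>n. b n * (\<Sum>k\<le>n. of_nat (n choose k) * z ^ k * e (n - k)))"
proof (intro exI allI impI)
  \<comment> \<open>\<open>?a k j\<close> is the part of the coefficient of z^k that comes from n =
    k + j. It does not involve \<open>z\<close>; the witness, fixed only in the final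
    \<open>show\<close>, is the row sum \<open>suminf (?a k)\<close>. Its growth C p^k is absorbed
    by |z| \<le> p^(-2).\<close>
  let ?a = "\<lambda>k j. b (k + j) * of_nat ((k + j) choose k) * e j"
  fix z :: 'c assume z: "av z \<le> (1 / real p) ^ 2"
  have a: "av (?a k j) \<le> (C * real p ^ k) * (1 / real p) ^ j" for k j
  proof -
    have "av (?a k j) \<le> real p ^ (k + j) * 1 * (C * (1 / real p) ^ (2 * j))"
      unfolding vabs_mult using b[of "k + j"] e[of j] by (intro mult_mono) auto
    also have "\<dots> = (C * real p ^ k) * (real p ^ j * (1 / real p) ^ (2 * j))"
      by (simp only: power_add mult_1_right mult_ac)
    finally show ?thesis unfolding inverse_p_cancel .
  qed
  have C: "C \<ge> 0"
    using order_trans[OF vabs_nonneg e[of 0]] by simp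
  have A: "av (z ^ k * ?a k j) \<le> C * (1 / real p) ^ (k + j)" for k j
  proof -
    have "av z ^ k \<le> (1 / real p) ^ (2 * k)"
      using power_mono[OF z, of k] by (simp add: power_mult)
    then have "av (z ^ k * ?a k j) \<le> (1 / real p) ^ (2 * k) * ((C * real p ^ k) * (1 / real p) ^ j)"
      unfolding vabs_mult[of "z ^ k"] vabs_power using a[of k j] by (intro mult_mono) auto
    also have "\<dots> = C * (real p ^ k * (1 / real p) ^ (2 * k)) * (1 / real p) ^ j"
      by (simp only: mult_ac)
    finally show ?thesis unfolding inverse_p_cancel by (simp only: power_add mult_ac)
  qed
  have "(\<lambda>j. z ^ k * ?a k j) sums (z ^ k * suminf (?a k))" for k
    using geometric_bound_summable[OF a, of k] inverse_p_range
    by (intro sums_mult_vabs summable_sums) auto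
  then have "suminf (\<lambda>j. z ^ k * ?a k j) = suminf (?a k) * z ^ k" for k
    by (rule trans[OF sums_unique[symmetric] mult.commute])
  moreover have "(\<Sum>k\<le>n. z ^ k * ?a k (n - k)) =
      b n * (\<Sum>k\<le>n. of_nat (n choose k) * z ^ k * e (n - k))" for n
    unfolding sum_distrib_left by (intro sum.cong) (simp_all add: mult_ac)
  ultimately show "(\<lambda>k. suminf (?a k) * z ^ k) sums
      (\<Sum>n. b n * (\<Sum>k\<le>n. of_nat (n choose k) * z ^ k * e (n - k)))"
    using sums_double[of "\<lambda>k j. z ^ k * ?a k j", OF A] inverse_p_range by simp
qed

section \<open>Powers of units close to 1 and their Teichmueller limit\<close>

lemma vabs_power_minus_1_le:
  assumes "av (u - 1) \<le> 1"
  shows "av (u ^ n - 1) \<le> av (u - 1)"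
proof (induction n)
  case (Suc n)
  have "av u \<le> 1"
    using vabs_add_le_max[of "u - 1" 1] assms by simp
  then have "av (u * (u ^ n - 1)) \<le> 1 * av (u - 1)"
    unfolding vabs_mult using Suc by (intro mult_mono) auto
  then have "av (u * (u ^ n - 1) + (u - 1)) \<le> av (u - 1)"
    using vabs_add_le_max[of "u * (u ^ n - 1)" "u - 1"] by linarith
  then show ?case
    by (simp add: algebra_simps)
qed simp

text \<open>u^p - 1 is u - 1 times the sum of the u^i with i < p; each u^i is congruent to 1 modulo
  p, so this sum is congruent to p and contributes a factor 1 / p.\<close>

lemma vabs_power_p_minus_1_le:
  assumes "av (u - 1) \<le> 1 / real p"
  shows "av (u ^ p - 1) \<le> av (u - 1) * (1 / real p)"
proof -
  have "av (\<Sum>i<p. u ^ i - 1) \<le> 1 / real p"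
  proof (rule vabs_sum_le)
    show "av (u ^ i - 1) \<le> 1 / real p" for i
      using vabs_power_minus_1_le[of u i] assms inverse_p_range by linarith
  qed simp
  moreover have "(\<Sum>i<p. u ^ i) = (\<Sum>i<p. u ^ i - 1) + of_nat p"
    by (simp add: sum_subtractf)
  ultimately have "av (\<Sum>i<p. u ^ i) \<le> 1 / real p"
    using vabs_add_le_max[of "\<Sum>i<p. u ^ i - 1" "of_nat p"] vabs_p by simp
  then show ?thesis
    unfolding power_diff_1_eq vabs_mult by (intro mult_left_mono) auto
qed

text \<open>Iterated p-th powers contract towards 1 by 1 / p at each step, and p^(n!) picks a
  subsequence. This evaluates the limit in \<open>teich\<close>.\<close>

lemma power_p_fact_tendsto_1:
  assumes "av (u - 1) \<le> 1 / real p"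
  shows "(\<lambda>n. u ^ (p ^ fact n)) \<longlonglongrightarrow> 1"
proof -
  have iter: "av (u ^ (p ^ n) - 1) \<le> (1 / real p) ^ Suc n" for n
  proof (induction n)
    case (Suc n)
    have "(1 / real p) ^ Suc n \<le> (1 / real p) ^ 1"
      using inverse_p_range by (intro power_decreasing) auto
    with Suc have "av (u ^ (p ^ n) - 1) \<le> 1 / real p"
      by simp
    from vabs_power_p_minus_1_le[OF this]
    have "av (u ^ (p ^ Suc n) - 1) \<le> av (u ^ (p ^ n) - 1) * (1 / real p)"
      by (simp add: power_mult[symmetric] mult.commute)
    also have "\<dots> \<le> (1 / real p) ^ Suc n * (1 / real p)"
      using Suc by (intro mult_right_mono) auto
    finally show ?case by simp
  qed (use assms in simp)
  have "(\<lambda>n. u ^ (p ^ n)) \<longlonglongrightarrow> 1"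
    unfolding tendsto_vabs_iff
  proof (rule Lim_null_comparison)
    show "\<forall>\<^sub>F n in sequentially. norm (av (u ^ p ^ n - 1)) \<le> (1 / real p) ^ Suc n"
      using iter by simp
    show "(\<lambda>n. (1 / real p) ^ Suc n) \<longlonglongrightarrow> 0"
      using inverse_p_range by (intro LIMSEQ_Suc LIMSEQ_power_zero) auto
  qed
  moreover have "filterlim (\<lambda>n. fact n :: nat) at_top at_top"
    using fact_ge_self by (intro filterlim_at_top_mono[OF filterlim_ident]) auto
  ultimately show ?thesis
    by (rule filterlim_compose)
qed

end

section \<open>Locally analytic functions and generalized distributions\<close>

context nonarch_field
begin

section \<open>Ultrametric balls\<close>

lemma ball_eq_ball:
  assumes "(y :: 'c) \<in> ball x r"
  shows "ball y r = ball x r"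
proof -
  have "z \<in> ball b r" if "b \<in> ball a r" "z \<in> ball a r" for a b z :: 'c
    using vabs_diff_le_max[of "a - z" "a - b"] that by (simp add: dist_vabs vabs_minus_commute)
  with assms show ?thesis
    by (metis (no_types) dist_commute mem_ball subsetI subset_antisym)
qed

lemma closed_ball_nonarch: "closed (ball x r :: 'c set)"
proof -
  have "open (- ball x r)"
    unfolding open_contains_ball
  proof
    fix y assume y: "y \<in> - ball x r"
    show "\<exists>e>0. ball y e \<subseteq> - ball x r"
    proof (cases "r > 0")
      case True
      have "z \<notin> ball x r" if "z \<in> ball y r" for z
      proof
        assume "z \<in> ball x r"
        then have "ball y r = ball x r"
          using ball_eq_ball that by blast
        with y True show False by auto
      qed
      then show ?thesis using True by blast
    next
      case False
      then show ?thesis by (intro exI[of _ 1]) (simp add: ball_empty)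
    qed
  qed
  then show ?thesis by (simp add: closed_def)
qed

section \<open>Closure properties of the spaces \<open>B\<close> and \<open>LA\<close>\<close>

lemma nbhd_mono: "S \<subseteq> S' \<Longrightarrow> r \<le> r' \<Longrightarrow> nbhd S r \<subseteq> nbhd S' (r' :: real)"
  unfolding nbhd_def by force

lemma B_bounded:
  assumes "f \<in> B r (S :: 'c set)"
  obtains M where "\<And>z. z \<in> nbhd S r \<Longrightarrow> av (f z) \<le> M"
  using assms by (auto simp: B_def bdd_above_def)

lemma B_antimono:
  assumes "f \<in> B r S" "r' \<le> r"
  shows "f \<in> B r' (S :: 'c set)"
proof -
  have "\<exists>c. \<forall>z\<in>ball a r'. (\<lambda>n. c n * (z - a) ^ n) sums f z" if "a \<in> S" for a
    using assms that subset_ball[OF assms(2)] unfolding B_def by blast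
  moreover have "bdd_above ((\<lambda>z. av (f z)) ` nbhd S r')"
  proof (rule bdd_above_mono)
    show "bdd_above ((\<lambda>z. av (f z)) ` nbhd S r)"
      using assms(1) by (simp add: B_def)
  qed (intro image_mono nbhd_mono order_refl assms(2))
  ultimately show ?thesis unfolding B_def by blast
qed

lemma B_cong:
  assumes "f \<in> B r S" "\<And>z. z \<in> nbhd S r \<Longrightarrow> g z = f z"
  shows "g \<in> B r (S :: 'c set)"
proof -
  have "g z = f z" if "a \<in> S" "z \<in> ball a r" for a z
    using assms(2) that unfolding nbhd_def by blast
  moreover have "(\<lambda>z. av (g z)) ` nbhd S r = (\<lambda>z. av (f z)) ` nbhd S r"
    using assms(2) by simp
  ultimately show ?thesis
    using assms(1) by (simp add: B_def)
qed

lemma B_add: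
  assumes "f \<in> B r S" "g \<in> B r S"
  shows "(\<lambda>z. f z + g z) \<in> B r (S :: 'c set)"
  unfolding B_def
proof (intro CollectI conjI ballI)
  fix a assume "a \<in> S"
  then obtain c d where "\<forall>z\<in>ball a r. (\<lambda>n. c n * (z - a) ^ n) sums f z"
    "\<forall>z\<in>ball a r. (\<lambda>n. d n * (z - a) ^ n) sums g z"
    using assms unfolding B_def by blast
  then show "\<exists>c. \<forall>z\<in>ball a r. (\<lambda>n. c n * (z - a) ^ n) sums (f z + g z)"
    by (intro exI[of _ "\<lambda>n. c n + d n"]) (auto simp: distrib_right intro: sums_add_vabs)
next
  obtain M N where M: "\<And>z. z \<in> nbhd S r \<Longrightarrow> av (f z) \<le> M" and N: "\<And>z. z \<in> nbhd S r \<Longrightarrow> av (g z) \<le> N"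
    using B_bounded assms by metis
  have "av (f z + g z) \<le> max M N" if "z \<in> nbhd S r" for z
    using vabs_add_le_max[of "f z" "g z"] M[OF that] N[OF that] by linarith
  then show "bdd_above ((\<lambda>z. av (f z + g z)) ` nbhd S r)"
    by (rule bdd_aboveI2)
qed

lemma B_mult:
  assumes "f \<in> B r S"
  shows "(\<lambda>z. k * f z) \<in> B r (S :: 'c set)"
  unfolding B_def
proof (intro CollectI conjI ballI)
  fix a assume "a \<in> S"
  then obtain c where "\<forall>z\<in>ball a r. (\<lambda>n. c n * (z - a) ^ n) sums f z"
    using assms unfolding B_def by blast
  then show "\<exists>c. \<forall>z\<in>ball a r. (\<lambda>n. c n * (z - a) ^ n) sums (k * f z)"
    by (intro exI[of _ "\<lambda>n. k * c n"]) (auto simp: mult.assoc intro: sums_mult_vabs)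
next
  obtain M where "\<And>z. z \<in> nbhd S r \<Longrightarrow> av (f z) \<le> M"
    using B_bounded[OF assms] by blast
  then show "bdd_above ((\<lambda>z. av (k * f z)) ` nbhd S r)"
    by (intro bdd_aboveI2[of _ _ "av k * M"]) (simp add: vabs_mult mult_left_mono)
qed

lemma B_zero: "(\<lambda>_. 0) \<in> B r (S :: 'c set)"
proof -
  have "\<exists>c. \<forall>z\<in>ball a r. (\<lambda>n. c n * (z - a) ^ n) sums (0 :: 'c)" for a
    by (intro exI[of _ "\<lambda>_. 0"]) simp
  then show ?thesis unfolding B_def by (auto intro: bdd_aboveI2)
qed

lemma B_sum:
  assumes "\<And>i. i \<in> A \<Longrightarrow> f i \<in> B r S"
  shows "(\<lambda>z. \<Sum>i\<in>A. k i * f i z) \<in> B r (S :: 'c set)"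
  using assms
  by (induction A rule: infinite_finite_induct) (auto intro!: B_zero B_add B_mult)

text \<open>Cutting off at \<open>D\<close> keeps the radius \<open>r\<close>, since on each ball
  the new function is either \<open>f\<close> or 0.\<close>

lemma B_restrict:
  assumes f: "f \<in> B r S" and D: "\<And>a. a \<in> S \<Longrightarrow> ball a r \<subseteq> D \<or> ball a r \<inter> D = {}"
  shows "(\<lambda>z. if z \<in> D then f z else 0) \<in> B r (S :: 'c set)"
  unfolding B_def
proof (intro CollectI conjI ballI)
  fix a assume a: "a \<in> S"
  show "\<exists>c. \<forall>z\<in>ball a r. (\<lambda>n. c n * (z - a) ^ n) sums (if z \<in> D then f z else 0)"
  proof (cases "ball a r \<subseteq> D")
    case True
    then show ?thesis using f a unfolding B_def by (auto simp: subset_iff)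
  next
    case False
    then have "z \<notin> D" if "z \<in> ball a r" for z using D[OF a] that by blast
    then show ?thesis by (intro exI[of _ "\<lambda>_. 0"]) auto
  qed
next
  obtain M where M: "\<And>z. z \<in> nbhd S r \<Longrightarrow> av (f z) \<le> M"
    using B_bounded[OF f] by blast
  have "av (if z \<in> D then f z else 0) \<le> M" if "z \<in> nbhd S r" for z
    using M[OF that] order_trans[OF vabs_nonneg M[OF that]] by auto
  then show "bdd_above ((\<lambda>z. av (if z \<in> D then f z else 0)) ` nbhd S r)"
    by (rule bdd_aboveI2)
qed

lemma LA_I: "r > 0 \<Longrightarrow> f \<in> B r S \<Longrightarrow> f \<in> LA (S :: 'c set)"
  unfolding LA_def by blast

lemma LA_add:
  assumes "f \<in> LA S" "g \<in> LA S"
  shows "(\<lambda>z. f z + g z) \<in> LA (S :: 'c set)"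
proof -
  obtain r s where "r > 0" "f \<in> B r S" "s > 0" "g \<in> B s S"
    using assms unfolding LA_def by auto
  then show ?thesis
    by (intro LA_I[of "min r s"] B_add) (auto intro: B_antimono)
qed

lemma LA_mult: "f \<in> LA S \<Longrightarrow> (\<lambda>z. k * f z) \<in> LA (S :: 'c set)"
  unfolding LA_def by (auto intro: B_mult)

lemma LA_zero: "(\<lambda>_. 0) \<in> LA (S :: 'c set)"
  using LA_I[of 1] B_zero by simp

lemma openin_LA_topology: "openin (LA_topology S) = LA_open (S :: 'c set)"
  unfolding LA_topology_def by (rule topology_inverse'[OF istopology_LA_open])

lemma topspace_LA_topology: "topspace (LA_topology S) = LA (S :: 'c set)"
proof -
  have "LA_zero_nbhd S (LA S)"
    unfolding LA_zero_nbhd_def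
    by (auto intro: LA_add LA_mult LA_I intro!: exI[of _ "1::real"])
  then have "LA_open S (LA S)"
    unfolding LA_open_def by (auto intro: LA_add)
  moreover have "U \<subseteq> LA S" if "LA_open S U" for U
    using that unfolding LA_open_def by blast
  ultimately show ?thesis
    unfolding topspace_def openin_LA_topology by blast
qed

section \<open>Continuous functionals: support and uniqueness of the integral\<close>

context
  fixes \<sigma> :: "'c set" and \<mu> :: "('c \<Rightarrow> 'c) \<Rightarrow> 'c"
  assumes compact: "compact \<sigma>" and dual: "\<mu> \<in> LA_dual \<sigma>"
begin

lemma dual_germ: "f \<in> LA \<sigma> \<Longrightarrow> g \<in> LA \<sigma> \<Longrightarrow> same_germ \<sigma> f g \<Longrightarrow> \<mu> f = \<mu> g"
  using dual unfolding LA_dual_def by blast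

lemma dual_add: "f \<in> LA \<sigma> \<Longrightarrow> g \<in> LA \<sigma> \<Longrightarrow> \<mu> (\<lambda>z. f z + g z) = \<mu> f + \<mu> g"
  using dual unfolding LA_dual_def by blast

lemma dual_mult: "f \<in> LA \<sigma> \<Longrightarrow> \<mu> (\<lambda>z. k * f z) = k * \<mu> f"
  using dual unfolding LA_dual_def by blast

lemma dual_zero: "\<mu> (\<lambda>_. 0) = 0"
  using dual_mult[OF LA_zero, of 0] by simp

lemma dual_sum:
  assumes "r > 0" "finite A" "\<And>i. i \<in> A \<Longrightarrow> f i \<in> B r \<sigma>"
  shows "\<mu> (\<lambda>z. \<Sum>i\<in>A. k i * f i z) = (\<Sum>i\<in>A. k i * \<mu> (f i))"
  using assms(2,3)
proof (induction A rule: finite_induct)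
  case (insert i A)
  have fi: "f i \<in> LA \<sigma>"
    using insert LA_I[OF assms(1)] by simp
  have "(\<lambda>z. \<Sum>i\<in>A. k i * f i z) \<in> LA \<sigma>"
    using insert by (intro LA_I[OF assms(1)] B_sum) auto
  from dual_add[OF LA_mult[OF fi, of "k i"] this] show ?case
    using insert dual_mult[OF fi, of "k i"] by simp
qed (simp add: dual_zero)

text \<open>The preimage of the unit ball is open for the inductive limit topology, hence contains a
  0-neighbourhood that meets each normed step in a small ball.\<close>

lemma dual_nbhd_zero:
  assumes "r > 0"
  shows "\<exists>\<epsilon>>0. \<forall>f\<in>B r \<sigma>. B_norm r \<sigma> f < \<epsilon> \<longrightarrow> av (\<mu> f) < 1"
proof -
  let ?V = "{f \<in> LA \<sigma>. \<mu> f \<in> ball 0 1}"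
  have "LA_open \<sigma> ?V"
    using dual openin_continuous_map_preimage[of "LA_topology \<sigma>" euclidean \<mu> "ball 0 1"]
    unfolding LA_dual_def topspace_LA_topology openin_LA_topology by simp
  moreover have "(\<lambda>_. 0) \<in> ?V"
    by (simp add: LA_zero dual_zero)
  ultimately obtain N where N: "LA_zero_nbhd \<sigma> N" "\<forall>h\<in>N. (\<lambda>z. 0 + h z) \<in> ?V"
    unfolding LA_open_def by blast
  then obtain \<epsilon> where "\<epsilon> > 0" "\<forall>f\<in>B r \<sigma>. B_norm r \<sigma> f < \<epsilon> \<longrightarrow> f \<in> N"
    using assms unfolding LA_zero_nbhd_def by blast
  with N(2) show ?thesis
    by (intro exI[of _ \<epsilon>]) (auto simp: dist_vabs)
qed

text \<open>Needed for the support to exist. A function living on a clopen \<open>W\<close> inside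
  the union is cut into finitely many pieces on balls of one small radius; such balls are disjoint
  or equal, so the pieces add up to \<open>f\<close>, and each piece lives in a single member of
  \<open>\<U>\<close>.\<close>

lemma vanishes_on_Union:
  assumes \<U>: "\<And>U. U \<in> \<U> \<Longrightarrow> openin (top_of_set \<sigma>) U \<and> vanishes_on \<sigma> \<mu> U"
  shows "vanishes_on \<sigma> \<mu> (\<Union>\<U>)"
  unfolding vanishes_on_def
proof (intro ballI allI impI, elim conjE)
  fix f W
  assume f: "f \<in> LA \<sigma>" and W: "clopen_in \<sigma> W" "W \<subseteq> \<Union>\<U>" and germ: "same_germ (\<sigma> - W) f (\<lambda>_. 0)"
  have "compact W"
    using W(1) compact closedin_compact unfolding clopen_in_def by blast
  have "W \<subseteq> \<Union>{G. open G \<and> \<sigma> \<inter> G \<in> \<U>}"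
  proof
    fix w assume "w \<in> W"
    then obtain U where "w \<in> U" "U \<in> \<U>" using W(2) by blast
    with \<U> obtain G where "open G" "U = \<sigma> \<inter> G" by (metis openin_open)
    with \<open>w \<in> U\<close> \<open>U \<in> \<U>\<close> show "w \<in> \<Union>{G. open G \<and> \<sigma> \<inter> G \<in> \<U>}" by blast
  qed
  \<comment> \<open>A Lebesgue number for the compact set \<open>W\<close> and its cover by the sets
    \<open>G\<close>.\<close>
  then obtain e0 where e0: "e0 > 0" "\<And>w. w \<in> W \<Longrightarrow> \<exists>G\<in>{G. open G \<and> \<sigma> \<inter> G \<in> \<U>}. ball w e0 \<subseteq> G"
    using Heine_Borel_lemma[OF \<open>compact W\<close>] by (metis (no_types, lifting) mem_Collect_eq)
  obtain r1 where r1: "r1 > 0" "f \<in> B r1 \<sigma>" using f unfolding LA_def by auto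
  obtain r2 where r2: "r2 > 0" "\<And>z. z \<in> nbhd (\<sigma> - W) r2 \<Longrightarrow> f z = 0"
    using germ unfolding same_germ_def by blast
  \<comment> \<open>Small enough for the cover, for the power series of \<open>f\<close> and for the
    vanishing of \<open>f\<close> off \<open>W\<close>.\<close>
  define e where "e = min e0 (min r1 r2)"
  have e: "e > 0" "e \<le> e0" "e \<le> r1" "e \<le> r2" using e0 r1 r2 unfolding e_def by auto
  have fe: "f \<in> B e \<sigma>" using B_antimono[OF r1(2)] e by simp
  have sub: "\<exists>U\<in>\<U>. ball w e \<inter> \<sigma> \<subseteq> U" if w: "w \<in> W" for w
    using e0(2)[OF w] subset_ball[OF e(2), of w] by blast
  have sat: "ball a e \<subseteq> (\<Union>w\<in>A. ball w e) \<or> ball a e \<inter> (\<Union>w\<in>A. ball w e) = {}"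
    for a :: 'c and A
  proof (cases "ball a e \<inter> (\<Union>w\<in>A. ball w e) = {}")
    case False
    then obtain w z where "w \<in> A" "z \<in> ball a e" "z \<in> ball w e" by blast
    then have "ball a e = ball w e"
      using ball_eq_ball[of z a e] ball_eq_ball[of z w e] by simp
    with \<open>w \<in> A\<close> show ?thesis by blast
  qed simp
  let ?g = "\<lambda>A z. if z \<in> (\<Union>w\<in>A. ball w e) then f z else 0"
  have g: "?g A \<in> B e \<sigma>" for A
    by (rule B_restrict[OF fe]) (use sat in auto)
  then have gLA: "?g A \<in> LA \<sigma>" for A using LA_I e(1) by blast
  have one: "\<mu> (?g {w}) = 0" if w: "w \<in> W" for w
  proof -
    obtain U where U: "U \<in> \<U>" "ball w e \<inter> \<sigma> \<subseteq> U" using sub w by blast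
    have "clopen_in \<sigma> (ball w e \<inter> \<sigma>)"
      unfolding clopen_in_def using closed_ball_nonarch[of w e]
      by (auto simp: Int_commute openin_open_Int closedin_closed_Int)
    moreover have "?g {w} z = 0" if z: "z \<in> nbhd (\<sigma> - (ball w e \<inter> \<sigma>)) e" for z
    proof -
      obtain a where a: "a \<in> \<sigma>" "a \<notin> ball w e" "z \<in> ball a e"
        using z unfolding nbhd_def by blast
      have "z \<notin> ball w e"
      proof
        assume "z \<in> ball w e"
        then have "ball a e = ball w e"
          using ball_eq_ball[of z a e] ball_eq_ball[of z w e] a(3) by simp
        with a(2) e(1) show False using centre_in_ball[of a e] by simp
      qed
      then show ?thesis by simp
    qed
    then have "same_germ (\<sigma> - (ball w e \<inter> \<sigma>)) (?g {w}) (\<lambda>_. 0)"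
      unfolding same_germ_def using e(1) by blast
    ultimately show ?thesis
      using \<U>[OF U(1)] U(2) gLA unfolding vanishes_on_def by blast
  qed
  have fin: "\<mu> (?g A) = 0" if "finite A" "A \<subseteq> W" for A
    using that
  proof (induction A rule: finite_induct)
    case empty
    then show ?case by (simp add: dual_zero)
  next
    case (insert w A)
    \<comment> \<open>The new ball is already covered by the old ones or adds a disjoint
      piece.\<close>
    show ?case
      using sat[of w A]
    proof
      assume "ball w e \<subseteq> (\<Union>w\<in>A. ball w e)"
      then have "(\<Union>w\<in>insert w A. ball w e) = (\<Union>w\<in>A. ball w e)" by blast
      then show ?thesis using insert by simp
    next
      assume "ball w e \<inter> (\<Union>w\<in>A. ball w e) = {}"
      then have "?g (insert w A) = (\<lambda>z. ?g {w} z + ?g A z)"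
        by (intro ext) (auto simp: disjoint_iff simp del: mem_ball)
      then show ?thesis
        using dual_add[OF gLA gLA, of "{w}" A] one[of w] insert by simp
    qed
  qed
  have "\<And>w. w \<in> W \<Longrightarrow> open (ball w e)" by simp
  moreover have "W \<subseteq> (\<Union>w\<in>W. ball w e)" using e(1) by auto
  ultimately obtain A where A: "A \<subseteq> W" "finite A" "W \<subseteq> (\<Union>w\<in>A. ball w e)"
    using compactE_image[OF \<open>compact W\<close>] by metis
  have "f z = ?g A z" if z: "z \<in> nbhd \<sigma> e" for z
  proof -
    obtain a where a: "a \<in> \<sigma>" "z \<in> ball a e" using z unfolding nbhd_def by blast
    show ?thesis
    proof (cases "a \<in> W")
      case True
      then obtain w where w: "w \<in> A" "a \<in> ball w e" using A(3) by blast
      then have "z \<in> ball w e" using a(2) ball_eq_ball by blast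
      with w(1) show ?thesis by auto
    next
      case False
      \<comment> \<open>Here f z = 0, so both branches of \<open>?g A\<close> agree with it.\<close>
      then have "z \<in> nbhd (\<sigma> - W) r2"
        using a subset_ball[OF e(4), of a] unfolding nbhd_def by blast
      then show ?thesis using r2(2) by simp
    qed
  qed
  then have "same_germ \<sigma> f (?g A)" unfolding same_germ_def using e(1) by blast
  then show "\<mu> f = 0"
    using dual_germ[OF f gLA] fin[OF A(2,1)] by simp
qed

text \<open>The union of all open vanishing sets is itself one of them, so \<open>GREATEST\<close>
  in \<open>supp\<close> denotes a true maximum.\<close>

lemma vanishes_on_complement_supp: "vanishes_on \<sigma> \<mu> (\<sigma> - supp \<sigma> \<mu>)"
proof -
  let ?P = "\<lambda>U. openin (top_of_set \<sigma>) U \<and> vanishes_on \<sigma> \<mu> U"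
  have P: "?P (\<Union>{U. ?P U})"
    using vanishes_on_Union[of "{U. ?P U}"] by (auto intro: openin_Union)
  then have "(GREATEST U. ?P U) = \<Union>{U. ?P U}"
    by (intro Greatest_equality) auto
  moreover have "\<Union>{U. ?P U} \<subseteq> \<sigma>"
    using openin_imp_subset by blast
  ultimately have "\<sigma> - supp \<sigma> \<mu> = \<Union>{U. ?P U}"
    unfolding supp_def by (simp add: double_diff)
  with P show ?thesis by simp
qed

text \<open>The difference of the two extensions vanishes near U \<inter> U', hence is carried by
  the clopen complement of this set in \<sigma>, which misses the support.\<close>

lemma has_gint_unique:
  assumes "has_gint \<sigma> \<mu> X \<phi> v" "has_gint \<sigma> \<mu> X \<phi> v'"
  shows "v = v'"
proof -
  obtain U g where g: "clopen_in \<sigma> U" "supp \<sigma> \<mu> \<subseteq> U" "g \<in> LA \<sigma>" "same_germ U g \<phi>" "v = \<mu> g"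
    using assms(1) unfolding has_gint_def by blast
  obtain U' g' where g': "clopen_in \<sigma> U'" "supp \<sigma> \<mu> \<subseteq> U'" "g' \<in> LA \<sigma>" "same_germ U' g' \<phi>" "v' = \<mu> g'"
    using assms(2) unfolding has_gint_def by blast
  let ?W = "\<sigma> - U \<inter> U'" and ?h = "\<lambda>z. g z + (-1) * g' z"
  have "clopen_in \<sigma> ?W"
    using g(1) g'(1) unfolding clopen_in_def by (auto intro: openin_diff closedin_diff)
  moreover have "?W \<subseteq> \<sigma> - supp \<sigma> \<mu>" using g(2) g'(2) by blast
  moreover have "same_germ (\<sigma> - ?W) ?h (\<lambda>_. 0)"
  proof -
    obtain r where r: "r > 0" "\<And>z. z \<in> nbhd U r \<Longrightarrow> g z = \<phi> z"
      using g(4) unfolding same_germ_def by blast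
    obtain r' where r': "r' > 0" "\<And>z. z \<in> nbhd U' r' \<Longrightarrow> g' z = \<phi> z"
      using g'(4) unfolding same_germ_def by blast
    have "?h z = 0" if "z \<in> nbhd (\<sigma> - ?W) (min r r')" for z
    proof -
      have "z \<in> nbhd U r" "z \<in> nbhd U' r'"
        using that by (auto simp: nbhd_def)
      then show ?thesis using r(2) r'(2) by simp
    qed
    then show ?thesis
      unfolding same_germ_def using r(1) r'(1) by (intro exI[of _ "min r r'"]) auto
  qed
  moreover have h: "?h \<in> LA \<sigma>" by (intro LA_add LA_mult g g')
  ultimately have "\<mu> ?h = 0"
    using vanishes_on_complement_supp unfolding vanishes_on_def by blast
  then show ?thesis
    using dual_add[OF g(3) LA_mult[OF g'(3)], of "-1"] dual_mult[OF g'(3), of "-1"] g(5) g'(5) by simp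
qed

end

end

context padic_field
begin

text \<open>Continuity becomes boundedness by scaling. The scalars are powers of p, which is why
  sizes are measured by (1 / p)^k and not by arbitrary reals.\<close>

lemma dual_bounded:
  assumes "\<mu> \<in> LA_dual \<sigma>" "compact (\<sigma> :: 'c set)" "r > 0"
  shows "\<exists>C. \<forall>f\<in>B r \<sigma>. \<forall>k. (\<forall>z\<in>nbhd \<sigma> r. av (f z) \<le> (1 / real p) ^ k) \<longrightarrow>
    av (\<mu> f) \<le> C * (1 / real p) ^ k"
proof -
  obtain \<epsilon> where \<epsilon>: "\<epsilon> > 0" "\<And>f. f \<in> B r \<sigma> \<Longrightarrow> B_norm r \<sigma> f < \<epsilon> \<Longrightarrow> av (\<mu> f) < 1"
    using dual_nbhd_zero[OF assms(2,1,3)] by blast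
  obtain E where E: "(1 / real p) ^ E < \<epsilon>"
    using real_arch_pow_inv[OF \<epsilon>(1) inverse_p_range(2)] by blast
  have "av (\<mu> f) \<le> real p ^ E * (1 / real p) ^ k"
    if f: "f \<in> B r \<sigma>" and bd: "\<forall>z\<in>nbhd \<sigma> r. av (f z) \<le> (1 / real p) ^ k" for f k
  proof -
    \<comment> \<open>Scales size p^(-k) to p^(-E), which is below \<epsilon>; the resulting
      constant is C = p^E.\<close>
    let ?c = "of_nat p ^ E / of_nat p ^ k :: 'c"
    have c: "av ?c = real p ^ k * (1 / real p) ^ E"
      unfolding vabs_divide vabs_power vabs_p by (simp add: field_simps)
    have "av (?c * f z) \<le> (1 / real p) ^ E" if "z \<in> nbhd \<sigma> r" for z
    proof -
      have "av (?c * f z) \<le> real p ^ k * (1 / real p) ^ E * (1 / real p) ^ k"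
        unfolding vabs_mult c using bd that by (intro mult_left_mono) auto
      also have "\<dots> = (1 / real p) ^ E"
        using real_p_gt_1 by (simp add: field_simps)
      finally show ?thesis .
    qed
    then have "B_norm r \<sigma> (\<lambda>z. ?c * f z) \<le> (1 / real p) ^ E"
      unfolding B_norm_def by (intro cSup_least) auto
    then have "av (\<mu> (\<lambda>z. ?c * f z)) < 1"
      by (intro \<epsilon>(2)[OF B_mult[OF f]] order_le_less_trans[OF _ E])
    then have "real p ^ k * (1 / real p) ^ E * av (\<mu> f) < 1"
      unfolding dual_mult[OF assms(2,1) LA_I[OF assms(3) f]] vabs_mult c .
    then show ?thesis
      using real_p_gt_1 by (simp add: field_simps)
  qed
  then show ?thesis by blast
qed

end

section \<open>The zeta function far away from the support\<close>

context padic_field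
begin

section \<open>The disc around \<open>l0\<close> and the values of \<open>angle\<close> on
  it\<close>

context
  fixes ppow :: "rat \<Rightarrow> 'c" and \<sigma> :: "'c set" and n0 :: nat and l0 :: 'c
  assumes ppow: "fractional_powers p ppow"
    and far: "\<And>a. a \<in> \<sigma> \<Longrightarrow> av a \<le> real p ^ n0"
    and l0_def: "l0 = ppow (- of_nat (n0 + 2))"
begin

lemma ppow_0: "ppow 0 = 1"
proof -
  have "ppow (0 + 1) = ppow 0 * ppow 1" "ppow 1 = of_nat p"
    using ppow unfolding fractional_powers_def by blast+
  moreover have "(of_nat p :: 'c) \<noteq> 0"
    using real_p_gt_1 by simp
  ultimately show ?thesis by simp
qed

lemma ppow_of_nat: "ppow (of_nat k) = of_nat p ^ k"
proof (induction k)
  case (Suc k)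
  have "ppow (1 + of_nat k) = ppow 1 * ppow (of_nat k)" "ppow 1 = of_nat p"
    using ppow unfolding fractional_powers_def by blast+
  with Suc show ?case by simp
qed (simp add: ppow_0)

lemma vabs_l0: "av l0 = real p ^ (n0 + 2)"
proof -
  have "ppow (of_nat (n0 + 2) + - of_nat (n0 + 2)) = ppow (of_nat (n0 + 2)) * l0"
    using ppow unfolding fractional_powers_def l0_def by blast
  then have "of_nat p ^ (n0 + 2) * l0 = 1"
    unfolding ppow_of_nat by (simp add: ppow_0)
  then have "av (of_nat p ^ (n0 + 2) * l0) = 1"
    by simp
  then have "(1 / real p) ^ (n0 + 2) * av l0 = 1"
    unfolding vabs_mult vabs_power vabs_p .
  then show ?thesis
    using real_p_gt_1 by (simp add: field_simps)
qed

lemma l0_nonzero: "l0 \<noteq> 0"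
proof -
  have "av l0 > 0" unfolding vabs_l0 using real_p_gt_1 by simp
  then show ?thesis by auto
qed

lemma vabs_divide_l0_le:
  assumes "av x \<le> real p ^ n0"
  shows "av (x / l0) \<le> (1 / real p) ^ 2"
proof -
  have "av (x / l0) \<le> real p ^ n0 / real p ^ (n0 + 2)"
    unfolding vabs_divide vabs_l0 using assms by (intro divide_right_mono) auto
  also have "\<dots> = (1 / real p) ^ 2"
    using real_p_gt_1 by (simp add: power_add power_one_over power2_eq_square)
  finally show ?thesis .
qed

lemma vabs_divide_l0_le_unit: "av x \<le> 1 \<Longrightarrow> av (x / l0) \<le> (1 / real p) ^ 2"
  using one_le_power[of "real p" n0] real_p_gt_1 by (intro vabs_divide_l0_le) linarith

text \<open>This is \<open>angle p ppow (l + x) - 1\<close>, see \<open>angle_eq\<close> below.\<close>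

definition defect :: "'c \<Rightarrow> 'c \<Rightarrow> 'c"
  where "defect l x = (x + l - l0) / l0"

lemma vabs_defect_le:
  assumes "l \<in> ball l0 1" "x \<in> nbhd \<sigma> 1"
  shows "av (defect l x) \<le> (1 / real p) ^ 2"
proof -
  obtain a where a: "a \<in> \<sigma>" "x \<in> ball a 1"
    using assms(2) unfolding nbhd_def by blast
  \<comment> \<open>Since p^n0 is at least 1, moving \<open>x\<close> off \<sigma> and
    \<open>l\<close> off \<open>l0\<close> by less than 1 does not spoil the bound p^n0 valid on
    \<sigma>.\<close>
  have one: "1 \<le> real p ^ n0"
    using real_p_gt_1 by (intro one_le_power) simp
  have "av (x - a) \<le> real p ^ n0" "av (l - l0) \<le> real p ^ n0"
    using a(2) assms(1) one by (auto simp: dist_vabs vabs_minus_commute)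
  then have "av (a + (x - a) + (l - l0)) \<le> real p ^ n0"
    using vabs_add_le_max[of a "x - a"] vabs_add_le_max[of "a + (x - a)" "l - l0"] far[OF a(1)]
    by linarith
  then show ?thesis
    unfolding defect_def by (intro vabs_divide_l0_le) (simp add: algebra_simps)
qed

lemma subset_nbhd: "a \<in> \<sigma> \<Longrightarrow> a \<in> nbhd \<sigma> 1"
  unfolding nbhd_def by (auto intro: bexI[of _ a])

context
  fixes l x :: 'c
  assumes l: "l \<in> ball l0 1" and x: "x \<in> nbhd \<sigma> 1"
begin

lemma add_eq_defect: "l + x = l0 * (1 + defect l x)"
  using l0_nonzero by (simp add: defect_def field_simps)

lemma vabs_defect_lt_1: "av (defect l x) < 1"
proof -
  have "(1 / real p) ^ 2 \<le> (1 / real p) ^ 1"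
    using inverse_p_range by (intro power_decreasing) auto
  then show ?thesis using vabs_defect_le[OF l x] inverse_p_range
    unfolding power_one_right by linarith
qed

lemma vabs_add_far: "av (l + x) = real p ^ (n0 + 2)"
  using vabs_add_eq[of "defect l x" 1] vabs_defect_lt_1
  unfolding add_eq_defect vabs_mult vabs_l0 by (simp add: add.commute)

text \<open>Evaluates the description in \<open>val\<close> and at the same time gives the unique
  existence demanded by \<open>angle_pow_defined\<close>.\<close>

lemma vabs_far_eq_powr_iff:
  "av (l + x) = real p powr (- of_rat r) \<longleftrightarrow> r = - of_nat (n0 + 2)"
proof -
  have "av (l + x) = real p powr real (n0 + 2)"
    unfolding vabs_add_far using real_p_gt_1 by (subst powr_realpow) auto
  then have "av (l + x) = real p powr (- of_rat r) \<longleftrightarrow> real (n0 + 2) = - of_rat r"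
    using real_p_gt_1 powr_inj[of "real p"] by simp
  also have "\<dots> \<longleftrightarrow> (of_rat r :: real) = of_rat (- of_nat (n0 + 2))"
    unfolding of_rat_minus of_rat_of_nat_eq by linarith
  finally show ?thesis by (simp only: of_rat_eq_iff)
qed

text \<open>\<open>l0\<close> is itself one of the chosen powers of p, so the unit part of l + x is
  exactly 1 + \<open>defect l x\<close>, close enough to 1 for its root of unity to be 1.\<close>

lemma omega_eq: "omega p ppow (l + x) = l0"
  and unit_part_convergent: "convergent (\<lambda>n. unit_part p ppow (l + x) ^ (p ^ fact n))"
proof -
  have val: "val p (l + x) = - of_nat (n0 + 2)"
    unfolding val_def vabs_far_eq_powr_iff by (rule the_equality) auto
  have u: "unit_part p ppow (l + x) = 1 + defect l x"
    unfolding unit_part_def val l0_def[symmetric] by (simp add: add_eq_defect l0_nonzero)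
  have "(1 / real p) ^ 2 \<le> (1 / real p) ^ 1"
    using inverse_p_range by (intro power_decreasing) auto
  then have "av (unit_part p ppow (l + x) - 1) \<le> 1 / real p"
    using vabs_defect_le[OF l x] unfolding u by simp
  then have lim: "(\<lambda>n. unit_part p ppow (l + x) ^ (p ^ fact n)) \<longlonglongrightarrow> 1"
    by (rule power_p_fact_tendsto_1)
  then show "convergent (\<lambda>n. unit_part p ppow (l + x) ^ (p ^ fact n))"
    by (rule convergentI)
  show "omega p ppow (l + x) = l0"
    unfolding omega_def teich_def val l0_def[symmetric] limI[OF lim] by simp
qed

lemma angle_eq: "angle p ppow (l + x) = 1 + defect l x"
  unfolding angle_def omega_eq by (simp add: add_eq_defect l0_nonzero)

text \<open>The factor 1 is the constant \<open>C\<close> of the geometric bounds.\<close>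

lemma vabs_series_term_le:
  assumes "av b \<le> real p ^ n"
  shows "av (b * defect l x ^ n) \<le> 1 * (1 / real p) ^ n"
proof -
  have "av (defect l x ^ n) \<le> (1 / real p) ^ (2 * n)"
    unfolding vabs_power using power_mono[OF vabs_defect_le[OF l x], of n] by (simp add: power_mult)
  then have "av (b * defect l x ^ n) \<le> real p ^ n * (1 / real p) ^ (2 * n)"
    unfolding vabs_mult using assms by (intro mult_mono) auto
  then show ?thesis unfolding inverse_p_cancel by simp
qed

end

text \<open>The coefficients are arbitrary so that one membership proof serves the binomial series
  as well as single powers of the defect.\<close>

definition series :: "(nat \<Rightarrow> 'c) \<Rightarrow> 'c \<Rightarrow> 'c \<Rightarrow> 'c"
  where "series b l x = (\<Sum>n. b n * defect l x ^ n)"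

lemma angle_pow_defined_far:
  assumes "l \<in> ball l0 1" "x \<in> nbhd \<sigma> 1" "av t \<le> 1"
  shows "angle_pow_defined p ppow (l + x) t"
    and "angle_pow p ppow (l + x) t = series (\<lambda>n. t gchoose n) l x"
proof -
  have "l + x \<noteq> 0"
    using vabs_add_far[OF assms(1,2)] real_p_gt_1 vabs_eq_0_iff[of "l + x"] by auto
  moreover have "\<exists>!r. av (l + x) = real p powr (- of_rat r)"
    unfolding vabs_far_eq_powr_iff[OF assms(1,2)] by auto
  moreover have "summable (\<lambda>n. (t gchoose n) * defect l x ^ n)"
    using geometric_bound_summable[OF vabs_series_term_le[OF assms(1,2) vabs_gbinomial_le[OF assms(3)]]]
      inverse_p_range by simp
  ultimately show "angle_pow_defined p ppow (l + x) t"
    unfolding angle_pow_defined_def omega_eq[OF assms(1,2)] angle_eq[OF assms(1,2)]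
    using unit_part_convergent[OF assms(1,2)] l0_nonzero by simp
  show "angle_pow p ppow (l + x) t = series (\<lambda>n. t gchoose n) l x"
    unfolding angle_pow_def angle_eq[OF assms(1,2)] series_def by simp
qed

context
  fixes b :: "nat \<Rightarrow> 'c"
  assumes b: "\<And>n. av (b n) \<le> real p ^ n"
begin

lemma vabs_series_tail_le:
  assumes "l \<in> ball l0 1" "x \<in> nbhd \<sigma> 1"
  shows "av (series b l x - (\<Sum>n<K. b n * defect l x ^ n)) \<le> (1 / real p) ^ K"
  using vabs_suminf_tail_le[of "\<lambda>n. b n * defect l x ^ n" 1 "1 / real p" K]
    vabs_series_term_le[OF assms b] inverse_p_range
  unfolding series_def by simp

text \<open>An instance of \<open>binomial_reexpand\<close>, with the powers of
  \<open>defect l a\<close> as \<open>e\<close> and (x - a) / l0 as variable; division by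
  \<open>l0\<close> makes the radius 1 work at all points of \<sigma>.\<close>

lemma series_in_B:
  assumes l: "l \<in> ball l0 1"
  shows "series b l \<in> B 1 \<sigma>"
  unfolding B_def
proof (intro CollectI conjI ballI)
  fix a assume a: "a \<in> \<sigma>"
  have e: "av (defect l a ^ j) \<le> 1 * (1 / real p) ^ (2 * j)" for j
    unfolding vabs_power using power_mono[OF vabs_defect_le[OF l subset_nbhd[OF a]], of j]
    by (simp add: power_mult)
  obtain c where c: "\<forall>z. av z \<le> (1 / real p) ^ 2 \<longrightarrow> (\<lambda>k. c k * z ^ k) sums
      (\<Sum>n. b n * (\<Sum>k\<le>n. of_nat (n choose k) * z ^ k * defect l a ^ (n - k)))"
    using binomial_reexpand[of b "\<lambda>j. defect l a ^ j", OF b e] by blast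
  have "(\<lambda>n. c n / l0 ^ n * (x - a) ^ n) sums series b l x" if x: "x \<in> ball a 1" for x
  proof -
    have "av ((x - a) / l0) \<le> (1 / real p) ^ 2"
      using x by (intro vabs_divide_l0_le_unit) (simp add: dist_vabs vabs_minus_commute)
    moreover have "(x - a) / l0 + defect l a = defect l x"
      by (simp add: defect_def add_divide_distrib[symmetric])
    ultimately have "(\<lambda>k. c k * ((x - a) / l0) ^ k) sums series b l x"
      using c[rule_format, of "(x - a) / l0"] unfolding binomial_ring[symmetric] series_def by simp
    then show ?thesis by (simp add: power_divide)
  qed
  then show "\<exists>c. \<forall>z\<in>ball a 1. (\<lambda>n. c n * (z - a) ^ n) sums series b l z"
    by (intro exI[of _ "\<lambda>n. c n / l0 ^ n"]) blast
next
  \<comment> \<open>The tail bound with K = 0 bounds the whole series.\<close>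
  have "av (series b l x) \<le> 1" if "x \<in> nbhd \<sigma> 1" for x
    using vabs_series_tail_le[OF l that, of 0] by simp
  then show "bdd_above ((\<lambda>z. av (series b l z)) ` nbhd \<sigma> 1)"
    by (rule bdd_aboveI2)
qed

end

text \<open>A power of the defect is a series with a Kronecker delta as coefficients.\<close>

lemma defect_power_in_B:
  assumes "l \<in> ball l0 1"
  shows "(\<lambda>x. defect l x ^ k) \<in> B 1 \<sigma>"
proof -
  let ?b = "\<lambda>n. if n = k then 1 else 0 :: 'c"
  have "av (?b n) \<le> real p ^ n" for n
    using real_p_gt_1 by (auto intro: one_le_power)
  from series_in_B[of ?b, OF this assms] have "series ?b l \<in> B 1 \<sigma>" .
  moreover have "series ?b l = (\<lambda>x. defect l x ^ k)"
  proof
    fix x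
    have "(\<lambda>n. ?b n * defect l x ^ n) = (\<lambda>n. if n = k then defect l x ^ n else 0)"
      by auto
    then show "series ?b l x = defect l x ^ k"
      unfolding series_def using sums_unique[OF sums_single[of k "\<lambda>n. defect l x ^ n"]] by simp
  qed
  ultimately show ?thesis by simp
qed

section \<open>Moments of \<mu> and termwise integration\<close>

context
  fixes \<mu> :: "('c \<Rightarrow> 'c) \<Rightarrow> 'c"
  assumes compact: "compact \<sigma>" and dual: "\<mu> \<in> LA_dual \<sigma>"
begin

lemma dual_bounded_1:
  obtains C where "\<And>f k. f \<in> B 1 \<sigma> \<Longrightarrow> (\<And>z. z \<in> nbhd \<sigma> 1 \<Longrightarrow> av (f z) \<le> (1 / real p) ^ k) \<Longrightarrow>
    av (\<mu> f) \<le> C * (1 / real p) ^ k"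
proof -
  obtain C where "\<forall>f\<in>B 1 \<sigma>. \<forall>k. (\<forall>z\<in>nbhd \<sigma> 1. av (f z) \<le> (1 / real p) ^ k) \<longrightarrow>
      av (\<mu> f) \<le> C * (1 / real p) ^ k"
    using dual_bounded[OF dual compact, of 1] by auto
  then show ?thesis by (intro that[of C]) blast
qed

definition moment :: "'c \<Rightarrow> nat \<Rightarrow> 'c"
  where "moment l n = \<mu> (\<lambda>x. defect l x ^ n)"

lemma moment_bounded:
  assumes "l \<in> ball l0 1"
  obtains C where "\<And>n. av (moment l n) \<le> C * (1 / real p) ^ (2 * n)"
proof -
  obtain C where C: "\<And>f k. f \<in> B 1 \<sigma> \<Longrightarrow>
      (\<And>z. z \<in> nbhd \<sigma> 1 \<Longrightarrow> av (f z) \<le> (1 / real p) ^ k) \<Longrightarrow> av (\<mu> f) \<le> C * (1 / real p) ^ k"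
    using dual_bounded_1 by blast
  have "av (moment l n) \<le> C * (1 / real p) ^ (2 * n)" for n
    unfolding moment_def
  proof (rule C[OF defect_power_in_B[OF assms]])
    show "av (defect l x ^ n) \<le> (1 / real p) ^ (2 * n)" if "x \<in> nbhd \<sigma> 1" for x
      unfolding vabs_power using power_mono[OF vabs_defect_le[OF assms that], of n]
      by (simp add: power_mult)
  qed
  then show ?thesis using that by blast
qed

text \<open>The remainder after K terms is at most p^(-K) on the whole neighbourhood of radius 1, so
  the boundedness of \<mu> on \<open>B 1 \<sigma>\<close> makes its image small.\<close>

lemma dual_series_sums:
  assumes b: "\<And>n. av (b n) \<le> real p ^ n" and l: "l \<in> ball l0 1"
  shows "(\<lambda>n. b n * moment l n) sums \<mu> (series b l)"
proof -
  obtain C where C: "\<And>f k. f \<in> B 1 \<sigma> \<Longrightarrow>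
      (\<And>z. z \<in> nbhd \<sigma> 1 \<Longrightarrow> av (f z) \<le> (1 / real p) ^ k) \<Longrightarrow> av (\<mu> f) \<le> C * (1 / real p) ^ k"
    using dual_bounded_1 by blast
  show ?thesis
  proof (rule sums_geometric_bound)
    fix K
    let ?S = "\<lambda>x. \<Sum>n<K. b n * defect l x ^ n"
    let ?h = "\<lambda>x. series b l x + (-1) * ?S x"
    have S: "?S \<in> B 1 \<sigma>" by (intro B_sum defect_power_in_B l)
    have "?h \<in> B 1 \<sigma>" by (intro B_add B_mult series_in_B b l S)
    moreover have "av (?h x) \<le> (1 / real p) ^ K" if "x \<in> nbhd \<sigma> 1" for x
      using vabs_series_tail_le[of b, OF b l that, of K] by simp
    ultimately have "av (\<mu> ?h) \<le> C * (1 / real p) ^ K" by (rule C)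
    moreover have "\<mu> ?h = \<mu> (series b l) + (-1) * \<mu> ?S"
    proof -
      have "series b l \<in> LA \<sigma>" "?S \<in> LA \<sigma>"
        using LA_I[OF zero_less_one] series_in_B[of b, OF b l] S by blast+
      then show ?thesis
        by (simp only: dual_add[OF compact dual] dual_mult[OF compact dual] LA_mult)
    qed
    moreover have "\<mu> ?S = (\<Sum>n<K. b n * moment l n)"
      unfolding moment_def by (intro dual_sum[OF compact dual, of 1] defect_power_in_B l) auto
    ultimately show "av (\<mu> (series b l) - (\<Sum>n<K. b n * moment l n)) \<le> C * (1 / real p) ^ K"
      by simp
  qed (use inverse_p_range in auto)
qed

text \<open>The binomial theorem under the integral separates the parameter from the integration
  variable: moments at \<open>l\<close> become polynomials in l - a with moments at \<open>a\<close>
  as coefficients.\<close>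

lemma moment_shift:
  assumes "l \<in> ball l0 1" "a \<in> ball l0 1"
  shows "moment l n = (\<Sum>k\<le>n. of_nat (n choose k) * ((l - a) / l0) ^ k * moment a (n - k))"
proof -
  have "defect l x = (l - a) / l0 + defect a x" for x
    by (simp add: defect_def add_divide_distrib[symmetric])
  then have "moment l n =
      \<mu> (\<lambda>x. \<Sum>k\<le>n. of_nat (n choose k) * ((l - a) / l0) ^ k * defect a x ^ (n - k))"
    unfolding moment_def by (simp add: binomial_ring)
  also have "\<dots> = (\<Sum>k\<le>n. of_nat (n choose k) * ((l - a) / l0) ^ k * moment a (n - k))"
    unfolding moment_def by (intro dual_sum[OF compact dual, of 1] defect_power_in_B assms) auto
  finally show ?thesis .
qed

text \<open>The same re-expansion as in x, with moments at \<open>a\<close> in place of powers of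
  the defect. The radius 1 stays inside the disc because a unit ball around any of its points is the
  disc itself.\<close>

lemma locally_analytic_on_dual_series:
  assumes b: "\<And>n. av (b n) \<le> real p ^ n"
  shows "locally_analytic_on (ball l0 1) (\<lambda>l. k * \<mu> (series b l))"
  unfolding locally_analytic_on_def
proof
  fix a assume a: "a \<in> ball l0 1"
  obtain C where C: "\<And>n. av (moment a n) \<le> C * (1 / real p) ^ (2 * n)"
    using moment_bounded[OF a] by blast
  obtain c where c: "\<forall>z. av z \<le> (1 / real p) ^ 2 \<longrightarrow> (\<lambda>k. c k * z ^ k) sums
      (\<Sum>n. b n * (\<Sum>k\<le>n. of_nat (n choose k) * z ^ k * moment a (n - k)))"
    using binomial_reexpand[of b, OF b C] by blast
  have "(\<lambda>n. k * (c n / l0 ^ n) * (l - a) ^ n) sums (k * \<mu> (series b l))" if "l \<in> ball a 1" for l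
  proof -
    have l: "l \<in> ball l0 1" using that ball_eq_ball[OF a] by blast
    have "av ((l - a) / l0) \<le> (1 / real p) ^ 2"
      using that by (intro vabs_divide_l0_le_unit) (simp add: dist_vabs vabs_minus_commute)
    from c[rule_format, OF this] have "(\<lambda>n. c n * ((l - a) / l0) ^ n) sums (\<Sum>n. b n * moment l n)"
      unfolding moment_shift[OF l a, symmetric] .
    also have "(\<Sum>n. b n * moment l n) = \<mu> (series b l)"
      using sums_unique[OF dual_series_sums[of b, OF b l]] by simp
    finally have "(\<lambda>n. k * (c n * ((l - a) / l0) ^ n)) sums (k * \<mu> (series b l))"
      by (rule sums_mult_vabs)
    then show ?thesis by (simp add: power_divide mult.assoc)
  qed
  then show "\<exists>r>0. \<exists>c. ball a r \<subseteq> ball l0 1 \<and>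
      (\<forall>z\<in>ball a r. (\<lambda>n. c n * (z - a) ^ n) sums (k * \<mu> (series b z)))"
    using ball_eq_ball[OF a] by (intro exI[of _ 1] conjI exI[of _ "\<lambda>n. k * (c n / l0 ^ n)"]) auto
qed

section \<open>The zeta function on the disc\<close>

context
  fixes s :: 'c
  assumes s: "av s \<le> 1"
begin

lemma vabs_1_minus: "av (1 - s) \<le> 1"
  using vabs_diff_le_max[of 1 s] s by simp

lemma gbinomial_1_minus_bound: "av ((1 - s) gchoose n) \<le> real p ^ n"
  by (rule vabs_gbinomial_le[OF vabs_1_minus])

text \<open>The power is analytic near all of \<sigma>, so U = \<sigma> serves as neighbourhood of
  the support and nothing has to be extended by 0.\<close>

lemma has_gint_angle_pow:
  assumes l: "l \<in> ball l0 1"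
  shows "has_gint \<sigma> \<mu> {x. angle_pow_defined p ppow (l + x) (1 - s)}
    (\<lambda>x. angle_pow p ppow (l + x) (1 - s)) (\<mu> (series (\<lambda>n. (1 - s) gchoose n) l))"
proof -
  let ?\<phi> = "\<lambda>x. angle_pow p ppow (l + x) (1 - s)" and ?g = "series (\<lambda>n. (1 - s) gchoose n) l"
  have eq: "?\<phi> x = ?g x" if "x \<in> nbhd \<sigma> 1" for x
    using angle_pow_defined_far(2)[OF l that vabs_1_minus] .
  have g: "?g \<in> B 1 \<sigma>" by (intro series_in_B gbinomial_1_minus_bound l)
  have "?\<phi> \<in> LA \<sigma>"
    using LA_I[of 1 ?\<phi>] B_cong[OF g eq] by simp
  moreover have "?g \<in> LA \<sigma>"
    using LA_I[of 1] g by simp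
  moreover have "same_germ \<sigma> ?g ?\<phi>"
    unfolding same_germ_def using eq by (intro exI[of _ 1]) auto
  moreover have "same_germ (\<sigma> - \<sigma>) ?g (\<lambda>_. 0)"
    unfolding same_germ_def nbhd_def by (intro exI[of _ 1]) auto
  moreover have "nbhd \<sigma> 1 \<subseteq> {x. angle_pow_defined p ppow (l + x) (1 - s)}"
    using angle_pow_defined_far(1)[OF l _ vabs_1_minus] by blast
  moreover have "clopen_in \<sigma> \<sigma>" "supp \<sigma> \<mu> \<subseteq> \<sigma>"
    by (auto simp: clopen_in_def supp_def)
  ultimately show ?thesis
    unfolding has_gint_def
    by (intro exI[of _ \<sigma>] exI[of _ ?g] conjI exI[of _ "1::real"]) auto
qed

lemma zeta_eq:
  assumes l: "l \<in> ball l0 1"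
  shows "zeta p ppow \<sigma> \<mu> s l = 1 / (s - 1) * \<mu> (series (\<lambda>n. (1 - s) gchoose n) l)"
proof -
  have "gint \<sigma> \<mu> {x. angle_pow_defined p ppow (l + x) (1 - s)}
      (\<lambda>x. angle_pow p ppow (l + x) (1 - s)) = \<mu> (series (\<lambda>n. (1 - s) gchoose n) l)"
    unfolding gint_def
    by (rule the_equality) (auto intro: has_gint_angle_pow[OF l] has_gint_unique[OF compact dual])
  then show ?thesis unfolding zeta_def by simp
qed

lemma zeta_defined_far:
  assumes l: "l \<in> ball l0 1" and "s \<noteq> 1"
  shows "zeta_defined p ppow \<sigma> \<mu> s l"
proof -
  \<comment> \<open>A point - l of \<sigma> would give 0 the absolute value p^(n0 + 2).\<close>
  have "- l \<notin> \<sigma>"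
  proof
    assume "- l \<in> \<sigma>"
    then have "av (l + - l) = real p ^ (n0 + 2)"
      by (intro vabs_add_far l subset_nbhd)
    then show False using real_p_gt_1 by simp
  qed
  then have "- l \<notin> supp \<sigma> \<mu>" unfolding supp_def by blast
  then show ?thesis
    unfolding zeta_defined_def
    using assms has_gint_angle_pow[OF l] has_gint_unique[OF compact dual] by blast
qed

end

text \<open>For fixed \<open>l\<close> the moments are constants, so the integral is a binomial
  series in \<open>s\<close>; dividing by s - 1 keeps it smooth because 1 is removed from the
  domain.\<close>

lemma C_infinity_on_zeta:
  assumes l: "l \<in> ball l0 1"
  shows "C_infinity_on (Zp - {1}) (\<lambda>s. zeta p ppow \<sigma> \<mu> s l)"
proof -
  let ?F = "\<lambda>s. \<mu> (series (\<lambda>n. (1 - s) gchoose n) l)"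
  have Zp: "av s \<le> 1" if "s \<in> Zp - {1}" for s
    using that unfolding Zp_def by blast
  obtain C where C: "\<And>n. av (moment l n) \<le> C * (1 / real p) ^ (2 * n)"
    using moment_bounded[OF l] by blast
  have sums: "(\<lambda>k. moment l k * ((1 - s) gchoose k)) sums ?F s" if "s \<in> Zp - {1}" for s
    using dual_series_sums[OF gbinomial_1_minus_bound[OF Zp[OF that]] l]
    by (simp add: mult.commute)
  have F: "C_infinity_on (Zp - {1}) ?F"
    unfolding C_infinity_on_def by (intro allI C_n_on_binomial_series[OF C Zp sums])
  have "C_n_on n (Zp - {1}) (\<lambda>s. zeta p ppow \<sigma> \<mu> s l)" for n
  proof -
    have "C_n_on n (Zp - {1}) (\<lambda>s. ?F s / (s - 1))"
      by (rule C_n_on_divide_linear[OF F]) simp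
    then show ?thesis
      using zeta_eq[OF Zp l] by (subst C_n_on_cong[where g = "\<lambda>s. ?F s / (s - 1)"]) auto
  qed
  then show ?thesis unfolding C_infinity_on_def by blast
qed

lemma locally_analytic_on_cong:
  assumes "\<And>z. z \<in> S \<Longrightarrow> f z = (g z :: 'c)"
  shows "locally_analytic_on S f \<longleftrightarrow> locally_analytic_on S g"
  unfolding locally_analytic_on_def
  using assms by (intro ball_cong ex_cong1 conj_cong refl) (auto simp: subset_iff)

lemma locally_analytic_on_zeta:
  assumes "av s \<le> 1"
  shows "locally_analytic_on (ball l0 1) (\<lambda>l. zeta p ppow \<sigma> \<mu> s l)"
  using locally_analytic_on_dual_series[OF gbinomial_1_minus_bound[OF assms]]
  by (subst locally_analytic_on_cong[OF zeta_eq[OF assms]])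

end

end

end

theorem theorem3p3:
  fixes p :: nat
    and ppow :: "rat \<Rightarrow> 'c::{field_char_0, complete_space}"
    and \<sigma> :: "'c set"
    and \<mu> :: "('c \<Rightarrow> 'c) \<Rightarrow> 'c"
  assumes "prime p" and "odd p"
    and "is_Cp p TYPE('c)"
    and "fractional_powers p ppow"
    and "compact \<sigma>"
    and "\<mu> \<in> LA_dual \<sigma>"
  shows "\<exists>\<Omega> :: 'c set. open \<Omega> \<and> \<Omega> \<noteq> {} \<and>
    (\<forall>l\<in>\<Omega>. \<forall>s\<in>Zp - {1}. zeta_defined p ppow \<sigma> \<mu> s l) \<and>
    (\<forall>l\<in>\<Omega>. C_infinity_on (Zp - {1}) (\<lambda>s. zeta p ppow \<sigma> \<mu> s l)) \<and>
    (\<forall>s\<in>Zp - {1}. locally_analytic_on \<Omega> (\<lambda>l. zeta p ppow \<sigma> \<mu> s l))"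
proof -
  interpret padic_field "TYPE('c)" p
    using assms(1,3) unfolding is_Cp_def by unfold_locales blast+
  obtain R where R: "\<And>a. a \<in> \<sigma> \<Longrightarrow> dist 0 a \<le> R"
    using compact_imp_bounded[OF assms(5)] bounded_any_center by metis
  obtain n0 where "R < real p ^ n0"
    using real_arch_pow[OF real_p_gt_1] by blast
  then have far: "vabs a \<le> real p ^ n0" if "a \<in> \<sigma>" for a
    using R[OF that] by (simp add: vabs_def dist_commute)
  let ?l0 = "ppow (- of_nat (n0 + 2))"
  have Zp: "vabs s \<le> 1" "s \<noteq> 1" if "s \<in> Zp - {1}" for s :: 'c
    using that unfolding Zp_def by blast+
  show ?thesis
  proof (intro exI[of _ "ball ?l0 1"] conjI ballI)
    show "ball ?l0 1 \<noteq> {}" by (simp add: ball_eq_empty)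
    show "zeta_defined p ppow \<sigma> \<mu> s l" if "l \<in> ball ?l0 1" "s \<in> Zp - {1}" for l s
      using zeta_defined_far[OF assms(4) far refl assms(5,6) _ that(1)] Zp[OF that(2)] by blast
    show "C_infinity_on (Zp - {1}) (\<lambda>s. zeta p ppow \<sigma> \<mu> s l)" if "l \<in> ball ?l0 1" for l
      using C_infinity_on_zeta[OF assms(4) far refl assms(5,6) that] .
    show "locally_analytic_on (ball ?l0 1) (\<lambda>l. zeta p ppow \<sigma> \<mu> s l)" if "s \<in> Zp - {1}" for s
      using locally_analytic_on_zeta[OF assms(4) far refl assms(5,6) Zp(1)[OF that]] .
  qed simp
qed

end
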